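(* Let $C_\star$ be a chain complex of FI-modules such that for every $k\in\mathbb{Z}$ the FI-module $C_k$ is $H_0^{\mathrm{FI}}$-acyclic and is generated in degrees $\le g_k$. Then for every $k$ with $g_k\ge 0$, the FI-module $H_k(C_\star)$ is generated in degrees $$\le \begin{cases} g_{k-1}+g_k+1 & \text{if } g_k>g_{k-1},\\ 2g_k & \text{if } g_k\le g_{k-1}.\end{cases}$$
   Context: $\mathbf{FI}$ is the category of finite sets and injections and $\mathbf{FB}$ the category of finite sets and bijections. An FI-module (resp. FB-module) is a functor $V$ from $\mathbf{FI}$ (resp. $\mathbf{FB}$) to $\mathbb{Z}$-modules; $V_S$ denotes its value at a finite set $S$. For an FI- or FB-module $W$, $\deg(W):=\min\{d\ge -1 : W_S=0 \text{ for } |S|>d\}\in\{-1,0,1,\dots\}\cup\{\infty\}$. The functor $H_0^{\mathrm{FI}}$ from FI-modules to FB-modules is $H_0^{\mathrm{FI}}(V)_S=\operatorname{coker}\big(\bigoplus_{T\subsetneq S}V_T\to V_S\big)$. For $i\ge 0$, $H_i^{\mathrm{FI}}$ is its $i$-th left derived functor, and $t_i(V):=\deg(H_i^{\mathrm{FI}}(V))$. An FI-module $V$ is $H_0^{\mathrm{FI}}$-acyclic if $H_i^{\mathrm{FI}}(V)=0$ for all $i\ge 1$, and is generated in degrees $\le g$ ($g$ an integer $\ge -1$) if $t_0(V)\le g$. $H_k(C_\star)$ denotes the ordinary (objectwise) homology of the complex, an FI-module. *)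

theory Defs
  imports "HOL-Algebra.Free_Abelian_Groups" "HOL-Library.Extended_Real"
begin

text \<open>
  The categories of finite sets and injections, resp. bijections, are replaced by their full
  subcategories on the finite sets of natural numbers (equivalent categories).  Morphisms are
  extensional functions, so that each of them is a single HOL function.  Values at infinite sets
  are junk.  Abelian groups (that is, \<open>\<int>\<close>-modules) are written multiplicatively, following
  HOL-Algebra.
\<close>

definition FI_mor :: "nat set \<Rightarrow> nat set \<Rightarrow> (nat \<Rightarrow> nat) set" where
  "FI_mor S T = {f \<in> S \<rightarrow>\<^sub>E T. inj_on f S}"

definition FB_mor :: "nat set \<Rightarrow> nat set \<Rightarrow> (nat \<Rightarrow> nat) set" where
  "FB_mor S T = {f \<in> S \<rightarrow>\<^sub>E T. bij_betw f S T}"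

record 'a fin_diagram =
  obj :: "nat set \<Rightarrow> 'a monoid"
  mor :: "nat set \<Rightarrow> nat set \<Rightarrow> (nat \<Rightarrow> nat) \<Rightarrow> 'a \<Rightarrow> 'a"

definition functor_to_Ab ::
    "(nat set \<Rightarrow> nat set \<Rightarrow> (nat \<Rightarrow> nat) set) \<Rightarrow> 'a fin_diagram \<Rightarrow> bool" where
  "functor_to_Ab Hom V \<longleftrightarrow>
     (\<forall>S. finite S \<longrightarrow> comm_group (obj V S)) \<and>
     (\<forall>S T f. finite S \<longrightarrow> finite T \<longrightarrow> f \<in> Hom S T \<longrightarrow> mor V S T f \<in> hom (obj V S) (obj V T)) \<and>
     (\<forall>S x. finite S \<longrightarrow> x \<in> carrier (obj V S) \<longrightarrow> mor V S S (\<lambda>i\<in>S. i) x = x) \<and>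
     (\<forall>S T U f g x. finite S \<longrightarrow> finite T \<longrightarrow> finite U \<longrightarrow> f \<in> Hom S T \<longrightarrow> g \<in> Hom T U \<longrightarrow>
        x \<in> carrier (obj V S) \<longrightarrow> mor V S U (compose S g f) x = mor V T U g (mor V S T f x))"

abbreviation FI_module :: "'a fin_diagram \<Rightarrow> bool" where
  "FI_module \<equiv> functor_to_Ab FI_mor"

abbreviation FB_module :: "'a fin_diagram \<Rightarrow> bool" where
  "FB_module \<equiv> functor_to_Ab FB_mor"

definition FI_module_map ::
    "'a fin_diagram \<Rightarrow> 'b fin_diagram \<Rightarrow> (nat set \<Rightarrow> 'a \<Rightarrow> 'b) \<Rightarrow> bool" where
  "FI_module_map V W \<phi> \<longleftrightarrow>
     (\<forall>S. finite S \<longrightarrow> \<phi> S \<in> hom (obj V S) (obj W S)) \<and>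
     (\<forall>S T f x. finite S \<longrightarrow> finite T \<longrightarrow> f \<in> FI_mor S T \<longrightarrow> x \<in> carrier (obj V S) \<longrightarrow>
        \<phi> T (mor V S T f x) = mor W S T f (\<phi> S x))"

definition submodule :: "'a fin_diagram \<Rightarrow> (nat set \<Rightarrow> 'a set) \<Rightarrow> 'a fin_diagram" where
  "submodule V K = \<lparr>obj = (\<lambda>S. (obj V S)\<lparr>carrier := K S\<rparr>), mor = mor V\<rparr>"

text \<open>A homomorphism \<open>h\<close> sends the coset \<open>N x\<close> to the coset \<open>N' (h x)\<close>, which is the set product
  of \<open>N'\<close> with the image of \<open>N x\<close> under \<open>h\<close>.\<close>

definition quotient_module ::
    "'a fin_diagram \<Rightarrow> (nat set \<Rightarrow> 'a set) \<Rightarrow> 'a set fin_diagram" where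
  "quotient_module V N =
     \<lparr>obj = (\<lambda>S. obj V S Mod N S),
      mor = (\<lambda>S T f X. N T <#>\<^bsub>obj V T\<^esub> (mor V S T f ` X))\<rparr>"

text \<open>The homology at \<open>V\<close> of \<open>V' \<rightarrow> V \<rightarrow> V''\<close>, with maps \<open>\<phi>\<close> and \<open>\<psi>\<close>.\<close>

definition homology_at ::
    "'b fin_diagram \<Rightarrow> 'a fin_diagram \<Rightarrow> 'c fin_diagram \<Rightarrow>
     (nat set \<Rightarrow> 'b \<Rightarrow> 'a) \<Rightarrow> (nat set \<Rightarrow> 'a \<Rightarrow> 'c) \<Rightarrow> 'a set fin_diagram" where
  "homology_at V' V V'' \<phi> \<psi> =
     quotient_module (submodule V (\<lambda>S. kernel (obj V S) (obj V'' S) (\<psi> S)))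
       (\<lambda>S. \<phi> S ` carrier (obj V' S))"

definition is_zero :: "'a fin_diagram \<Rightarrow> bool" where
  "is_zero W \<longleftrightarrow> (\<forall>S. finite S \<longrightarrow> carrier (obj W S) = {\<one>\<^bsub>obj W S\<^esub>})"

definition deg :: "'a fin_diagram \<Rightarrow> ereal" where
  "deg W = Inf {ereal (real_of_int d) | d. - 1 \<le> d \<and>
     (\<forall>S. finite S \<longrightarrow> d < int (card S) \<longrightarrow> carrier (obj W S) = {\<one>\<^bsub>obj W S\<^esub>})}"


subsection \<open>The functor \<open>H\<^sub>0\<close>\<close>

text \<open>The image of the direct sum of the \<open>V\<^sub>T\<close>, for proper subsets \<open>T\<close> of \<open>S\<close>, in \<open>V\<^sub>S\<close>;
  the quotient by it is regarded as an FB-module.\<close>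

definition lower :: "'a fin_diagram \<Rightarrow> nat set \<Rightarrow> 'a set" where
  "lower V S =
     (\<lambda>x. finprod (obj V S) (\<lambda>T. mor V T S (\<lambda>i\<in>T. i) (x T)) {T. T \<subset> S})
       ` carrier (sum_group {T. T \<subset> S} (obj V))"

definition FI_H0 :: "'a fin_diagram \<Rightarrow> 'a set fin_diagram" where
  "FI_H0 V = quotient_module V (lower V)"

definition FI_H0_map ::
    "'b fin_diagram \<Rightarrow> (nat set \<Rightarrow> 'a \<Rightarrow> 'b) \<Rightarrow> nat set \<Rightarrow> 'a set \<Rightarrow> 'b set" where
  "FI_H0_map W \<phi> S X = lower W S <#>\<^bsub>obj W S\<^esub> (\<phi> S ` X)"


subsection \<open>The standard free resolution\<close>

text \<open>
  A generator \<open>(S, f, x)\<close> is the image under the injection \<open>f\<close> of a basis element \<open>x\<close> placed at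
  the finite set \<open>S\<close>.  The free FI-module on the family \<open>X\<close> is thus the direct sum, over \<open>S\<close> and
  \<open>x \<in> X S\<close>, of the linearised representable functors \<open>\<int>[FI(S, -)]\<close>; in particular it is projective.
\<close>

type_synonym 'b gen = "nat set \<times> (nat \<Rightarrow> nat) \<times> 'b"

definition push :: "(nat \<Rightarrow> nat) \<Rightarrow> ('b gen \<Rightarrow>\<^sub>0 int) \<Rightarrow> ('b gen \<Rightarrow>\<^sub>0 int)" where
  "push g = frag_extend (\<lambda>(S, f, x). frag_of (S, compose S g f, x))"

definition free_FI :: "(nat set \<Rightarrow> 'b set) \<Rightarrow> ('b gen \<Rightarrow>\<^sub>0 int) fin_diagram" where
  "free_FI X =
     \<lparr>obj = (\<lambda>T. free_Abelian_group {(S, f, x). finite S \<and> f \<in> FI_mor S T \<and> x \<in> X S}),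
      mor = (\<lambda>T U g. push g)\<rparr>"

text \<open>
  The resolution of \<open>V\<close> is built inductively: \<open>P\<^sub>0\<close> is free on all elements of \<open>V\<close>, and
  \<open>P\<^bsub>n+1\<^esub>\<close> is free on all formal integer combinations of generators of \<open>P\<^sub>n\<close> whose value lies in
  the kernel of the map out of \<open>P\<^sub>n\<close>.  The recursive datatype of basis elements lets all \<open>P\<^sub>n\<close> live
  in one type.  Different combinations may have the same value, so the basis is redundant; the map
  onto the kernel is nevertheless surjective.
\<close>

datatype 'a cell =
    Elt (elt: 'a)
  | Syz "(int \<times> nat set \<times> (nat \<Rightarrow> nat) \<times> 'a cell) list"

definition comb :: "(int \<times> 'b gen) list \<Rightarrow> ('b gen \<Rightarrow>\<^sub>0 int)" where
  "comb xs = (\<Sum>(n, e)\<leftarrow>xs. frag_cmul n (frag_of e))"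

primrec cell_bd :: "'a cell \<Rightarrow> ('a cell gen \<Rightarrow>\<^sub>0 int)" where
  "cell_bd (Elt v) = 0"
| "cell_bd (Syz xs) = comb xs"

definition bd :: "('a cell gen \<Rightarrow>\<^sub>0 int) \<Rightarrow> ('a cell gen \<Rightarrow>\<^sub>0 int)" where
  "bd = frag_extend (\<lambda>(S, f, x). push f (cell_bd x))"

definition augm :: "'a fin_diagram \<Rightarrow> nat set \<Rightarrow> ('a cell gen \<Rightarrow>\<^sub>0 int) \<Rightarrow> 'a" where
  "augm V T c =
     finprod (obj V T)
       (\<lambda>(S, f, x). mor V S T f (elt x) [^]\<^bsub>obj V T\<^esub> Poly_Mapping.lookup c (S, f, x))
       (Poly_Mapping.keys c)"

primrec res_basis :: "'a fin_diagram \<Rightarrow> nat \<Rightarrow> nat set \<Rightarrow> 'a cell set" where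
  "res_basis V 0 = (\<lambda>S. Elt ` carrier (obj V S))"
| "res_basis V (Suc n) = (\<lambda>S. {Syz xs | xs.
     comb xs \<in> carrier (obj (free_FI (res_basis V n)) S) \<and>
     (if n = 0 then augm V S (comb xs) = \<one>\<^bsub>obj V S\<^esub> else bd (comb xs) = 0)})"

definition res :: "'a fin_diagram \<Rightarrow> nat \<Rightarrow> ('a cell gen \<Rightarrow>\<^sub>0 int) fin_diagram" where
  "res V n = free_FI (res_basis V n)"

text \<open>The differential \<open>P\<^sub>n \<rightarrow> P\<^bsub>n-1\<^esub>\<close>; for \<open>n = 0\<close> it is the zero map, formally from \<open>P\<^sub>0\<close> to
  itself, instead of the map from \<open>P\<^sub>0\<close> to zero.\<close>

definition res_diff :: "nat \<Rightarrow> nat set \<Rightarrow> ('a cell gen \<Rightarrow>\<^sub>0 int) \<Rightarrow> ('a cell gen \<Rightarrow>\<^sub>0 int)" where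
  "res_diff n S = (if n = 0 then (\<lambda>_. 0) else bd)"


subsection \<open>Left derived functors of \<open>H\<^sub>0\<close>, acyclicity and generation degree\<close>

definition FI_H :: "nat \<Rightarrow> 'a fin_diagram \<Rightarrow> ('a cell gen \<Rightarrow>\<^sub>0 int) set set fin_diagram" where
  "FI_H i V =
     homology_at (FI_H0 (res V (i + 1))) (FI_H0 (res V i)) (FI_H0 (res V (i - 1)))
       (FI_H0_map (res V i) (res_diff (i + 1)))
       (FI_H0_map (res V (i - 1)) (res_diff i))"

definition H0_acyclic :: "'a fin_diagram \<Rightarrow> bool" where
  "H0_acyclic V \<longleftrightarrow> (\<forall>i\<ge>1. is_zero (FI_H i V))"

text \<open>The zeroth left derived functor of the right exact functor \<open>H\<^sub>0\<close> is \<open>H\<^sub>0\<close> itself, so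
  \<open>t\<^sub>0\<close> is defined directly by the cokernel.\<close>

definition t0 :: "'a fin_diagram \<Rightarrow> ereal" where
  "t0 V = deg (FI_H0 V)"

definition generated_in_degrees_le :: "'a fin_diagram \<Rightarrow> int \<Rightarrow> bool" where
  "generated_in_degrees_le V g \<longleftrightarrow> t0 V \<le> ereal (real_of_int g)"


subsection \<open>Chain complexes of FI-modules\<close>

definition FI_chain_complex ::
    "(int \<Rightarrow> 'a fin_diagram) \<Rightarrow> (int \<Rightarrow> nat set \<Rightarrow> 'a \<Rightarrow> 'a) \<Rightarrow> bool" where
  "FI_chain_complex C d \<longleftrightarrow>
     (\<forall>k. FI_module (C k)) \<and>
     (\<forall>k. FI_module_map (C k) (C (k - 1)) (d k)) \<and>
     (\<forall>k S x. finite S \<longrightarrow> x \<in> carrier (obj (C k) S) \<longrightarrow>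
        d (k - 1) S (d k S x) = \<one>\<^bsub>obj (C (k - 2)) S\<^esub>)"

definition complex_homology ::
    "(int \<Rightarrow> 'a fin_diagram) \<Rightarrow> (int \<Rightarrow> nat set \<Rightarrow> 'a \<Rightarrow> 'a) \<Rightarrow> int \<Rightarrow> 'a set fin_diagram" where
  "complex_homology C d k =
     homology_at (C (k + 1)) (C k) (C (k - 1)) (d (k + 1)) (d k)"

end

(*
  H_k is a quotient of the kernel Z of A = C_k -> B = C_{k-1}, so it suffices to bound the degrees
  of generators of Z.  Call V derivative-torsion-free if V and all its iterated derivatives
  DV = coker(V -> V shifted by one point) have injective maps V -> shift of V.

  If H_1(B) = 0, then B is derivative-torsion-free: with P -> B the first step of the free
  resolution and K its kernel, H_1(B) = 0 says that an element of K supported on generators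
  from proper subsets is a sum of elements of K from proper subsets.

  If A is generated in degrees <= a, and B is derivative-torsion-free and generated in degrees <= b,
  then Z is generated in degrees <= min(2a, a+b+1).  This goes by induction on derivatives: Z' =
  ker(DA -> DB) is generated in degrees <= min(2a, a+b+1) - 2, and Z'/DZ is the kernel of the map
  from B/im A to its shift, on which all non-surjective injections act by zero, so that it vanishes
  above the degrees of its generators.  So DZ = Z' above degree min(2a, a+b+1) - 2, hence DZ is
  generated in degrees <= min(2a, a+b+1) - 1 and Z in one degree more.  The induction ends at
  a = 0 or B = 0.
*)

theory Submission
  imports Defs
begin

subsection \<open>Lower parts and degrees of generation\<close>

text \<open>No derivative is ever formed, since iterated quotients would change the type at each
  step. The value at T - J of the |J|-th derivative of V is represented by V_T modulo the sum of the
  images of V_(T - {i}) for i in J; one more derivative means moving a point from T - J into J. The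
  equation |T - J| + 2|J| = |T| + |J| turns a bound that drops by two with each derivative into a
  single comparison with |T| + |J|.

  The two terms of the minimum belong to the two ways in which the induction ends. After a
  derivatives A is generated in degree 0, and so is the kernel, which gives 0 + 2a. After b + 1
  derivatives B is zero and the kernel is all of the derivative of A, generated in degrees at most a
  - b - 1, which gives (a - b - 1) + 2(b + 1) = a + b + 1.

  The vanishing of H_1(B) speaks of all points of a set at once, torsion-freeness of the derivatives
  of an arbitrary subset J. The supports of formal sums in P are what leads from one to the
  other.\<close>

definition incl :: "'a fin_diagram \<Rightarrow> nat set \<Rightarrow> nat set \<Rightarrow> 'a \<Rightarrow> 'a" where
  "incl V T S = mor V T S (\<lambda>i\<in>T. i)"

text \<open>The lower part of a value depends on inclusions only. The free modules and the
  subquotients below are shown to have this structure, and are not treated as functors on all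
  injections.\<close>

definition inclusion_diagram :: "'a fin_diagram \<Rightarrow> bool" where
  "inclusion_diagram V \<longleftrightarrow>
     (\<forall>S. finite S \<longrightarrow> comm_group (obj V S)) \<and>
     (\<forall>T S. finite S \<longrightarrow> T \<subseteq> S \<longrightarrow> incl V T S \<in> hom (obj V T) (obj V S))"

lemma inclusion_diagram_group:
  assumes "inclusion_diagram V" "finite S"
  shows "comm_group (obj V S)" "group (obj V S)"
  using assms by (auto simp: inclusion_diagram_def comm_group.axioms(2))

lemma inclusion_diagram_hom:
  "inclusion_diagram V \<Longrightarrow> finite S \<Longrightarrow> T \<subseteq> S \<Longrightarrow> incl V T S \<in> hom (obj V T) (obj V S)"
  by (auto simp: inclusion_diagram_def)

lemma (in comm_group) finprod_in_subgroup:
  assumes "subgroup H G" "finite A" "\<And>x. x \<in> A \<Longrightarrow> f x \<in> H"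
  shows "finprod G f A \<in> H"
  using assms(2,3)
proof (induction A)
  case empty
  then show ?case using subgroup.one_closed[OF assms(1)] by simp
next
  case (insert x F)
  have "f y \<in> carrier G" if "y \<in> insert x F" for y
    using insert.prems that subgroup.mem_carrier[OF assms(1)] by blast
  then have "finprod G f (insert x F) = f x \<otimes> finprod G f F"
    using insert.hyps by (intro finprod_insert) auto
  then show ?case
    using insert subgroup.m_closed[OF assms(1)] by simp
qed

text \<open>The set \<open>lower V S\<close> is the image of a homomorphism from a direct sum, hence
  a subgroup, and elements with one nontrivial component hit each generator. In this form
  containments can be tested on generators.\<close>

lemma lower_eq_generate:
  assumes V: "inclusion_diagram V" and S: "finite S"
  shows "lower V S = generate (obj V S) (\<Union>T\<in>{T. T \<subset> S}. incl V T S ` carrier (obj V T))"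
    (is "_ = generate ?G ?X")
proof -
  let ?I = "{T. T \<subset> S}"
  interpret G: comm_group ?G using inclusion_diagram_group[OF V S] by blast
  have fin: "finite ?I" by (rule finite_subset[of _ "Pow S"]) (use S in auto)
  have finT: "finite T" if "T \<in> ?I" for T using that S finite_subset by auto
  have hom: "incl V T S \<in> hom (obj V T) ?G" if "T \<in> ?I" for T
    using that inclusion_diagram_hom[OF V S] by auto
  have grp: "group (obj V T)" if "T \<in> ?I" for T
    using that finT inclusion_diagram_group[OF V] by blast
  have cs: "carrier (sum_group ?I (obj V)) =
      {x \<in> \<Pi>\<^sub>E T\<in>?I. carrier (obj V T). finite {T \<in> ?I. x T \<noteq> \<one>\<^bsub>obj V T\<^esub>}}"
    by (rule carrier_sum_group) (use grp in auto)
  have cl: "incl V T S (x T) \<in> carrier ?G" if "x \<in> carrier (sum_group ?I (obj V))" "T \<in> ?I" for x T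
    using that hom_in_carrier[OF hom[OF that(2)]] by (auto simp: cs)
  let ?h = "\<lambda>x. gfinprod ?G (\<lambda>T. incl V T S (x T)) ?I"
  have h: "?h \<in> hom (sum_group ?I (obj V)) ?G"
    by (rule G.hom_group_sum) (use hom grp in auto)
  have eq: "lower V S = ?h ` carrier (sum_group ?I (obj V))"
    unfolding lower_def incl_def[symmetric]
  proof (rule image_cong[OF refl])
    fix x assume "x \<in> carrier (sum_group ?I (obj V))"
    then show "finprod ?G (\<lambda>T. incl V T S (x T)) ?I = ?h x"
      using fin cl by (intro G.gfinprod_eq_finprod[symmetric]) auto
  qed
  interpret h: group_hom "sum_group ?I (obj V)" ?G ?h
    using h grp by (intro group_hom.intro group_hom_axioms.intro sum_group G.group_axioms) auto
  have sub: "subgroup (lower V S) ?G"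
    unfolding eq by (rule h.img_is_subgroup)
  have XG: "?X \<subseteq> carrier ?G" using hom_in_carrier[OF hom] by auto
  have sg: "subgroup (generate ?G ?X) ?G" by (rule G.generate_is_subgroup[OF XG])
  show ?thesis
  proof
    show "lower V S \<subseteq> generate ?G ?X"
      unfolding lower_def incl_def[symmetric]
    proof clarify
      fix x assume x: "x \<in> carrier (sum_group ?I (obj V))"
      show "finprod ?G (\<lambda>T. incl V T S (x T)) ?I \<in> generate ?G ?X"
      proof (rule G.finprod_in_subgroup[OF sg fin])
        fix T assume "T \<in> ?I"
        then have "x T \<in> carrier (obj V T)" using x by (auto simp: cs)
        then show "incl V T S (x T) \<in> generate ?G ?X"
          using \<open>T \<in> ?I\<close> by (intro generate.incl) auto
      qed
    qed
    show "generate ?G ?X \<subseteq> lower V S"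
    proof (rule G.generate_subgroup_incl[OF _ sub], rule subsetI)
      fix z assume "z \<in> ?X"
      then obtain T y where T: "T \<subset> S" and y: "y \<in> carrier (obj V T)" and z: "z = incl V T S y"
        by blast
      define x where "x = (\<lambda>U\<in>?I. if T = U then y else \<one>\<^bsub>obj V U\<^esub>)"
      have "(if T = U then y else \<one>\<^bsub>obj V U\<^esub>) \<in> carrier (obj V U)" if "U \<in> ?I" for U
        using y monoid.one_closed[OF group.is_monoid[OF grp[OF that]]] by auto
      then have x: "x \<in> carrier (sum_group ?I (obj V))"
        unfolding cs x_def using finite_subset[OF _ fin] by simp
      have "?h x = finprod ?G (\<lambda>U. incl V U S (x U)) ?I"
        using fin cl[OF x] by (intro G.gfinprod_eq_finprod) auto
      also have "\<dots> = finprod ?G (\<lambda>U. if T = U then incl V U S (x U) else \<one>\<^bsub>?G\<^esub>) ?I"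
      proof (rule G.finprod_cong'[OF refl])
        show "(\<lambda>U. if T = U then incl V U S (x U) else \<one>\<^bsub>?G\<^esub>) \<in> ?I \<rightarrow> carrier ?G"
          using cl[OF x] by auto
        show "incl V U S (x U) = (if T = U then incl V U S (x U) else \<one>\<^bsub>?G\<^esub>)" if "U \<in> ?I" for U
          using hom_one[OF hom[OF that] grp[OF that] G.group_axioms] that
          by (auto simp: x_def)
      qed
      also have "\<dots> = incl V T S (x T)"
        using T fin cl[OF x]
        by (intro G.finprod_singleton[where f = "\<lambda>U. incl V U S (x U)"]) auto
      finally have "?h x = z"
        using T by (simp add: x_def z)
      then show "z \<in> lower V S"
        unfolding eq using x by (rule image_eqI[OF sym])
    qed
  qed
qed

lemma lower_subgroup:
  assumes V: "inclusion_diagram V" and S: "finite S"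
  shows "subgroup (lower V S) (obj V S)"
proof -
  interpret G: comm_group "obj V S" using inclusion_diagram_group[OF V S] by blast
  show ?thesis
    unfolding lower_eq_generate[OF V S]
    by (rule G.generate_is_subgroup)
      (use hom_in_carrier[OF inclusion_diagram_hom[OF V S]] in auto)
qed

lemma deg_le_iff:
  assumes "-1 \<le> n"
  shows "deg W \<le> ereal (real_of_int n) \<longleftrightarrow>
    (\<forall>S. finite S \<longrightarrow> n < int (card S) \<longrightarrow> carrier (obj W S) = {\<one>\<^bsub>obj W S\<^esub>})"
proof
  let ?P = "\<lambda>d::int. - 1 \<le> d \<and>
     (\<forall>S. finite S \<longrightarrow> d < int (card S) \<longrightarrow> carrier (obj W S) = {\<one>\<^bsub>obj W S\<^esub>})"
  assume "deg W \<le> ereal (real_of_int n)"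
  \<comment> \<open>Comparing the infimum strictly with n + 1 yields an actual member d of the set;
    integrality turns d < n + 1 into d <= n.\<close>
  then have "Inf {ereal (real_of_int d) | d. ?P d} < ereal (real_of_int (n + 1))"
    unfolding deg_def by (rule le_less_trans) simp
  then obtain d where "?P d" "d < n + 1"
    unfolding Inf_less_iff by auto
  then show "\<forall>S. finite S \<longrightarrow> n < int (card S) \<longrightarrow> carrier (obj W S) = {\<one>\<^bsub>obj W S\<^esub>}"
    by auto
next
  assume "\<forall>S. finite S \<longrightarrow> n < int (card S) \<longrightarrow> carrier (obj W S) = {\<one>\<^bsub>obj W S\<^esub>}"
  then show "deg W \<le> ereal (real_of_int n)"
    unfolding deg_def using assms by (intro Inf_lower) auto
qed

lemma (in group) FactGroup_trivial_iff:
  assumes "subgroup N G"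
  shows "carrier (G Mod N) = {\<one>\<^bsub>G Mod N\<^esub>} \<longleftrightarrow> N = carrier G"
proof
  assume *: "carrier (G Mod N) = {\<one>\<^bsub>G Mod N\<^esub>}"
  have "x \<in> N" if "x \<in> carrier G" for x
  proof -
    have "N #> x \<in> carrier (G Mod N)" using that by (auto simp: FactGroup_def RCOSETS_def)
    then have "N #> x = N" using * by (auto simp: FactGroup_def)
    then show ?thesis using rcos_self[OF that assms] by simp
  qed
  then show "N = carrier G" using subgroup.subset[OF assms] by blast
next
  assume N: "N = carrier G"
  have "carrier G #> x = carrier G" if "x \<in> carrier G" for x
    using coset_join2[OF that subgroup_self that] .
  then show "carrier (G Mod N) = {\<one>\<^bsub>G Mod N\<^esub>}"
    unfolding N FactGroup_def RCOSETS_def by (auto intro: exI[of _ \<one>])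
qed

lemma generated_in_degrees_le_iff:
  assumes V: "inclusion_diagram V" and "-1 \<le> n"
  shows "generated_in_degrees_le V n \<longleftrightarrow>
    (\<forall>S. finite S \<longrightarrow> n < int (card S) \<longrightarrow> lower V S = carrier (obj V S))"
proof -
  have "carrier (obj (FI_H0 V) S) = {\<one>\<^bsub>obj (FI_H0 V) S\<^esub>} \<longleftrightarrow> lower V S = carrier (obj V S)"
    if "finite S" for S
    using group.FactGroup_trivial_iff[OF inclusion_diagram_group(2)[OF V that] lower_subgroup[OF V that]]
    by (simp add: FI_H0_def quotient_module_def)
  then show ?thesis
    unfolding generated_in_degrees_le_def t0_def deg_le_iff[OF assms(2)] by auto
qed

subsection \<open>FI-modules and their inclusions\<close>

lemma FI_mor_inclusion: "T \<subseteq> S \<Longrightarrow> (\<lambda>i\<in>T. i) \<in> FI_mor T S"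
  by (auto simp: FI_mor_def inj_on_def)

lemma FI_module_inclusion_diagram:
  assumes "FI_module V"
  shows "inclusion_diagram V"
proof -
  have "incl V T S \<in> hom (obj V T) (obj V S)" if "finite S" "T \<subseteq> S" for T S
    using assms that(1) finite_subset[OF that(2,1)] FI_mor_inclusion[OF that(2)]
    by (simp add: functor_to_Ab_def incl_def)
  then show ?thesis
    using assms by (simp add: inclusion_diagram_def functor_to_Ab_def)
qed

lemma FI_module_group:
  assumes "FI_module V" "finite S"
  shows "comm_group (obj V S)" "group (obj V S)"
  using inclusion_diagram_group FI_module_inclusion_diagram assms by blast+

lemma FI_module_hom:
  assumes "FI_module V" "finite S" "finite T" "f \<in> FI_mor S T"
  shows "mor V S T f \<in> hom (obj V S) (obj V T)"
    and "group_hom (obj V S) (obj V T) (mor V S T f)"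
  using assms FI_module_group by (auto simp: functor_to_Ab_def group_hom_def group_hom_axioms_def)

lemma FI_module_compose:
  assumes "FI_module V" "finite S" "finite T" "finite U" "f \<in> FI_mor S T" "g \<in> FI_mor T U"
    "x \<in> carrier (obj V S)"
  shows "mor V T U g (mor V S T f x) = mor V S U (compose S g f) x"
  using assms by (simp add: functor_to_Ab_def)

lemma incl_hom:
  assumes "FI_module V" "finite T" "S \<subseteq> T"
  shows "incl V S T \<in> hom (obj V S) (obj V T)"
    and "group_hom (obj V S) (obj V T) (incl V S T)"
  using FI_module_hom[OF assms(1) finite_subset[OF assms(3,2)] assms(2) FI_mor_inclusion[OF assms(3)]]
  by (simp_all add: incl_def)

lemma incl_closed:
  assumes "FI_module V" "finite T" "S \<subseteq> T" "x \<in> carrier (obj V S)"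
  shows "incl V S T x \<in> carrier (obj V T)"
  using hom_in_carrier[OF incl_hom(1)[OF assms(1-3)] assms(4)] .

lemma incl_incl:
  assumes "FI_module V" "finite U" "S \<subseteq> T" "T \<subseteq> U" "x \<in> carrier (obj V S)"
  shows "incl V T U (incl V S T x) = incl V S U x"
proof -
  have "compose S (\<lambda>i\<in>T. i) (\<lambda>i\<in>S. i) = (\<lambda>i\<in>S. i)"
    using assms(3) by (auto simp: compose_def fun_eq_iff)
  moreover have T: "finite T"
    by (rule finite_subset[OF assms(4,2)])
  moreover have "finite S"
    by (rule finite_subset[OF assms(3) T])
  ultimately show ?thesis
    using FI_module_compose[OF assms(1) _ _ assms(2) FI_mor_inclusion FI_mor_inclusion] assms
    by (simp add: incl_def)
qed

lemma incl_refl: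
  assumes "FI_module V" "finite S" "x \<in> carrier (obj V S)"
  shows "incl V S S x = x"
  using assms by (simp add: functor_to_Ab_def incl_def)

lemma mor_incl:
  assumes "FI_module V" "finite T" "finite U" "f \<in> FI_mor T U" "S \<subseteq> T"
    "x \<in> carrier (obj V S)"
  shows "mor V T U f (incl V S T x) = mor V S U (restrict f S) x"
proof -
  have "compose S f (\<lambda>i\<in>S. i) = restrict f S"
    using assms(5) by (auto simp: compose_def fun_eq_iff)
  then show ?thesis
    using FI_module_compose[OF assms(1) finite_subset[OF assms(5,2)] assms(2,3)
        FI_mor_inclusion[OF assms(5)] assms(4,6)]
    by (simp add: incl_def)
qed

lemma incl_mor:
  assumes "FI_module V" "finite S" "finite U" "f \<in> FI_mor S T" "T \<subseteq> U"
    "x \<in> carrier (obj V S)"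
  shows "incl V T U (mor V S T f x) = mor V S U f x"
proof -
  have "compose S (\<lambda>i\<in>T. i) f = f"
    using assms(4) by (auto simp: compose_def FI_mor_def fun_eq_iff PiE_def extensional_def)
  then show ?thesis
    using FI_module_compose[OF assms(1,2) finite_subset[OF assms(5,3)] assms(3,4)
        FI_mor_inclusion[OF assms(5)] assms(6)]
    by (simp add: incl_def)
qed

lemma FI_module_map_hom:
  assumes "FI_module V" "FI_module W" "FI_module_map V W \<phi>" "finite S"
  shows "group_hom (obj V S) (obj W S) (\<phi> S)"
  using assms(3,4) FI_module_group(2)[OF assms(1,4)] FI_module_group(2)[OF assms(2,4)]
  by (simp add: FI_module_map_def group_hom_def group_hom_axioms_def)

lemma FI_module_map_incl:
  assumes "FI_module_map V W \<phi>" "finite T" "S \<subseteq> T" "x \<in> carrier (obj V S)"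
  shows "\<phi> T (incl V S T x) = incl W S T (\<phi> S x)"
  using assms FI_mor_inclusion[OF assms(3)] finite_subset[OF assms(3,2)]
  by (simp add: FI_module_map_def incl_def)

section \<open>Subgroups tested on generators, and lower parts along a set of points\<close>

lemma hom_image_generate:
  assumes "group_hom G H h" "X \<subseteq> carrier G" "subgroup K H" "\<And>x. x \<in> X \<Longrightarrow> h x \<in> K"
    "x \<in> generate G X"
  shows "h x \<in> K"
proof -
  interpret group_hom G H h by fact
  interpret K: subgroup K H by fact
  have XG: "x \<in> carrier G" if "x \<in> generate G X" for x
    using that G.generate_in_carrier[OF assms(2)] by blast
  show ?thesis
    using assms(5)
  proof (induction x)
    case (inv x)
    then show ?case using assms(2,4) by (simp add: subset_iff K.m_inv_closed)
  next
    case (eng x y)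
    then show ?case using XG by (simp add: K.m_closed)
  qed (use assms(4) K.one_closed in auto)
qed

lemma subgroup_preimage:
  assumes "group_hom G H h" "subgroup K H"
  shows "subgroup {x \<in> carrier G. h x \<in> K} G"
proof -
  interpret group_hom G H h by fact
  interpret K: subgroup K H by fact
  show ?thesis
  proof (rule subgroup.intro)
    show "inv\<^bsub>G\<^esub> x \<in> {x \<in> carrier G. h x \<in> K}" if "x \<in> {x \<in> carrier G. h x \<in> K}" for x
      using that by (simp add: K.m_inv_closed)
  qed (simp_all add: K.m_closed K.one_closed subset_iff)
qed

text \<open>The quotient of \<open>obj V T\<close> by this subgroup represents the value at T - J of
  the |J|-th derivative of V. For J = {} nothing is divided out; for J = T the quotient is
  H_0.\<close>

definition lower_along :: "'a fin_diagram \<Rightarrow> nat set \<Rightarrow> nat set \<Rightarrow> 'a set" where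
  "lower_along V J T = generate (obj V T) (\<Union>i\<in>J. incl V (T - {i}) T ` carrier (obj V (T - {i})))"

lemma lower_along_gens_subset:
  assumes "FI_module V" "finite T"
  shows "(\<Union>i\<in>J. incl V (T - {i}) T ` carrier (obj V (T - {i}))) \<subseteq> carrier (obj V T)"
  using incl_closed[OF assms] by blast

lemma lower_along_subgroup:
  assumes "FI_module V" "finite T"
  shows "subgroup (lower_along V J T) (obj V T)"
  unfolding lower_along_def
  by (rule group.generate_is_subgroup[OF FI_module_group(2)[OF assms] lower_along_gens_subset[OF assms]])

lemma lower_along_subset: "FI_module V \<Longrightarrow> finite T \<Longrightarrow> lower_along V J T \<subseteq> carrier (obj V T)"
  using subgroup.subset[OF lower_along_subgroup] .

lemma lower_along_mono: "FI_module V \<Longrightarrow> finite T \<Longrightarrow> J \<subseteq> J' \<Longrightarrow> lower_along V J T \<subseteq> lower_along V J' T"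
  unfolding lower_along_def by (rule group.mono_generate[OF FI_module_group(2)]) auto

lemma lower_along_least:
  assumes "FI_module V" "finite T" "subgroup H (obj V T)"
    and "\<And>i x. i \<in> J \<Longrightarrow> x \<in> carrier (obj V (T - {i})) \<Longrightarrow> incl V (T - {i}) T x \<in> H"
  shows "lower_along V J T \<subseteq> H"
  unfolding lower_along_def
  by (rule group.generate_subgroup_incl[OF FI_module_group(2)[OF assms(1,2)] _ assms(3)])
    (use assms(4) in auto)

text \<open>An injection that misses i factors through T - {i}.\<close>

lemma mor_in_lower_along:
  assumes V: "FI_module V" and "finite S" "finite T" "f \<in> FI_mor S T" "i \<in> J" "i \<notin> f ` S"
    "x \<in> carrier (obj V S)"
  shows "mor V S T f x \<in> lower_along V J T"
proof -
  have f: "f \<in> FI_mor S (T - {i})"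
    using assms(4,6) unfolding FI_mor_def by (simp add: PiE_iff) (metis image_eqI)
  have "mor V S (T - {i}) f x \<in> carrier (obj V (T - {i}))"
    by (rule hom_in_carrier[OF FI_module_hom(1)[OF V assms(2) _ f] assms(7)]) (use assms(3) in simp)
  moreover have "incl V (T - {i}) T (mor V S (T - {i}) f x) = mor V S T f x"
    by (rule incl_mor[OF V assms(2,3) f Diff_subset assms(7)])
  ultimately have "mor V S T f x \<in> incl V (T - {i}) T ` carrier (obj V (T - {i}))"
    by (rule image_eqI[OF sym, rotated])
  then show ?thesis
    unfolding lower_along_def using assms(5) by (intro generate.incl) blast
qed

lemma incl_in_lower_along:
  assumes "FI_module V" "finite T" "S \<subseteq> T" "i \<in> J" "i \<notin> S" "x \<in> carrier (obj V S)"
  shows "incl V S T x \<in> lower_along V J T"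
  unfolding incl_def using assms finite_subset[OF assms(3,2)] FI_mor_inclusion
  by (intro mor_in_lower_along) auto

text \<open>Since f is injective, its restriction to T - {i} misses f i.\<close>

lemma mor_lower_along:
  assumes V: "FI_module V" and T: "finite T" and U: "finite U" and f: "f \<in> FI_mor T U"
    and J: "J \<subseteq> T" and x: "x \<in> lower_along V J T"
  shows "mor V T U f x \<in> lower_along V (f ` J) U"
proof (rule hom_image_generate[OF FI_module_hom(2)[OF V T U f] lower_along_gens_subset[OF V T]
      lower_along_subgroup[OF V U] _ x[unfolded lower_along_def]])
  fix y assume "y \<in> (\<Union>i\<in>J. incl V (T - {i}) T ` carrier (obj V (T - {i})))"
  then obtain i z where i: "i \<in> J" and z: "z \<in> carrier (obj V (T - {i}))"
    and y: "y = incl V (T - {i}) T z" by blast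
  have "restrict f (T - {i}) \<in> FI_mor (T - {i}) U" "f i \<notin> restrict f (T - {i}) ` (T - {i})"
    using f i J by (auto simp: FI_mor_def inj_on_def)
  then show "mor V T U f y \<in> lower_along V (f ` J) U"
    unfolding y mor_incl[OF V T U f Diff_subset z] using T U i z
    by (intro mor_in_lower_along[OF V _ _ _ imageI]) auto
qed

lemma incl_lower_along:
  assumes "FI_module V" "finite T" "S \<subseteq> T" "J \<subseteq> S" "x \<in> lower_along V J S"
  shows "incl V S T x \<in> lower_along V J T"
proof -
  have "(\<lambda>i\<in>S. i) ` J = J" using assms(4) by auto
  then show ?thesis
    using mor_lower_along[OF assms(1) finite_subset[OF assms(3,2)] assms(2)
        FI_mor_inclusion[OF assms(3)] assms(4,5)]
    by (simp add: incl_def)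
qed

lemma map_lower_along:
  assumes V: "FI_module V" and W: "FI_module W" and \<phi>: "FI_module_map V W \<phi>" and T: "finite T"
    and x: "x \<in> lower_along V J T"
  shows "\<phi> T x \<in> lower_along W J T"
proof (rule hom_image_generate[OF FI_module_map_hom[OF V W \<phi> T] lower_along_gens_subset[OF V T]
      lower_along_subgroup[OF W T] _ x[unfolded lower_along_def]])
  fix y assume "y \<in> (\<Union>i\<in>J. incl V (T - {i}) T ` carrier (obj V (T - {i})))"
  then obtain i z where i: "i \<in> J" and z: "z \<in> carrier (obj V (T - {i}))"
    and y: "y = incl V (T - {i}) T z" by blast
  have "\<phi> (T - {i}) z \<in> carrier (obj W (T - {i}))"
    using group_hom.hom_closed[OF FI_module_map_hom[OF V W \<phi>]] T z by blast
  then show "\<phi> T y \<in> lower_along W J T"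
    unfolding y FI_module_map_incl[OF \<phi> T Diff_subset z] using i
    by (intro incl_in_lower_along[OF W T]) auto
qed

text \<open>A proper subset of S misses some point i, so its inclusion factors through S -
  {i}.\<close>

lemma lower_eq_lower_along:
  assumes V: "FI_module V" and S: "finite S"
  shows "lower V S = lower_along V S S"
proof
  note I = FI_module_inclusion_diagram[OF V]
  show "lower V S \<subseteq> lower_along V S S"
    unfolding lower_eq_generate[OF I S]
  proof (rule group.generate_subgroup_incl[OF FI_module_group(2)[OF V S] _ lower_along_subgroup[OF V S]], rule subsetI)
    fix z assume "z \<in> (\<Union>T\<in>{T. T \<subset> S}. incl V T S ` carrier (obj V T))"
    then obtain T x where T: "T \<subset> S" and x: "x \<in> carrier (obj V T)" and z: "z = incl V T S x"
      by blast
    then obtain i where "i \<in> S" "i \<notin> T" by blast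
    then show "z \<in> lower_along V S S"
      using T x unfolding z by (intro incl_in_lower_along[OF V S]) auto
  qed
  show "lower_along V S S \<subseteq> lower V S"
  proof (rule lower_along_least[OF V S lower_subgroup[OF I S]])
    fix i x assume "i \<in> S" "x \<in> carrier (obj V (S - {i}))"
    then show "incl V (S - {i}) S x \<in> lower V S"
      unfolding lower_eq_generate[OF I S] by (intro generate.incl) blast
  qed
qed

subsection \<open>Kernels of maps into modules with torsion-free derivatives\<close>

definition generated_below :: "'a fin_diagram \<Rightarrow> int \<Rightarrow> bool" where
  "generated_below V g \<longleftrightarrow>
     (\<forall>S. finite S \<longrightarrow> g < int (card S) \<longrightarrow> carrier (obj V S) \<subseteq> lower_along V S S)"

lemma in_set_multI: "x \<in> H \<Longrightarrow> y \<in> K \<Longrightarrow> x \<otimes>\<^bsub>G\<^esub> y \<in> H <#>\<^bsub>G\<^esub> K"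
  by (auto simp: set_mult_def)

lemma in_set_multE:
  assumes "z \<in> H <#>\<^bsub>G\<^esub> K"
  obtains x y where "x \<in> H" "y \<in> K" "z = x \<otimes>\<^bsub>G\<^esub> y"
  using assms by (auto simp: set_mult_def)

lemma (in group) set_mult_upper1: "subgroup H G \<Longrightarrow> subgroup K G \<Longrightarrow> H \<subseteq> H <#> K"
  using in_set_multI[of _ H \<one> K G] subgroup.one_closed subgroup.mem_carrier by fastforce

lemma (in group) set_mult_upper2: "subgroup H G \<Longrightarrow> subgroup K G \<Longrightarrow> K \<subseteq> H <#> K"
  using in_set_multI[of \<one> H _ K G] subgroup.one_closed subgroup.mem_carrier by fastforce

lemma (in group) subgroup_cancel_left:
  assumes H: "subgroup H G" and a: "a \<in> H" and ax: "a \<otimes> x \<in> H" and x: "x \<in> carrier G"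
  shows "x \<in> H"
proof -
  have "a \<in> carrier G" using subgroup.mem_carrier[OF H a] .
  then have "inv a \<otimes> (a \<otimes> x) = x" using x by (simp add: m_assoc[symmetric])
  then show ?thesis
    using subgroup.m_closed[OF H subgroup.m_inv_closed[OF H a] ax] by simp
qed

lemma incl_image_subgroup:
  assumes "FI_module V" "finite T" "S \<subseteq> T"
  shows "subgroup (incl V S T ` carrier (obj V S)) (obj V T)"
  by (rule group_hom.img_is_subgroup[OF incl_hom(2)[OF assms]])

text \<open>Each derivative lowers the degree of generation by one, so for |J| >= g the |J|-th
  derivative is generated by its value at the empty set, which V_J represents. The induction peels
  off the points outside J.\<close>

lemma generated_below_split:
  assumes V: "FI_module V" and g: "generated_below V g" and "finite T" "J \<subseteq> T" "g \<le> int (card J)"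
  shows "carrier (obj V T) \<subseteq> lower_along V J T <#>\<^bsub>obj V T\<^esub> incl V J T ` carrier (obj V J)"
  using assms(3-5)
proof (induction "card T" arbitrary: T rule: less_induct)
  case less
  note T = \<open>finite T\<close> and JT = \<open>J \<subseteq> T\<close>
  interpret G: comm_group "obj V T" by (rule FI_module_group(1)[OF V T])
  let ?H = "lower_along V J T" and ?K = "incl V J T ` carrier (obj V J)"
  have sub: "subgroup ?H (obj V T)" "subgroup ?K (obj V T)"
    using lower_along_subgroup[OF V T] incl_image_subgroup[OF V T JT] by auto
  have sg: "subgroup (?H <#>\<^bsub>obj V T\<^esub> ?K) (obj V T)"
    by (rule G.mult_subgroups[OF sub])
  show ?case
  proof (cases "J = T")
    case True
    have "carrier (obj V T) \<subseteq> ?K"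
      using incl_refl[OF V T] True by (auto simp: image_iff)
    then show ?thesis using G.set_mult_upper2[OF sub] by blast
  next
    case False
    then have "card J < card T" using JT T by (intro psubset_card_mono) auto
    then have "carrier (obj V T) \<subseteq> lower_along V T T"
      using g less.prems(3) T unfolding generated_below_def by auto
    also have "\<dots> \<subseteq> ?H <#>\<^bsub>obj V T\<^esub> ?K"
    proof (rule lower_along_least[OF V T sg])
      fix i x assume i: "i \<in> T" and x: "x \<in> carrier (obj V (T - {i}))"
      let ?U = "T - {i}"
      show "incl V ?U T x \<in> ?H <#>\<^bsub>obj V T\<^esub> ?K"
      proof (cases "i \<in> J")
        case True
        then have "incl V ?U T x \<in> ?H"
          using x by (intro incl_in_lower_along[OF V T Diff_subset True]) auto
        then show ?thesis using G.set_mult_upper1[OF sub] by blast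
      next
        case False
        have JU: "J \<subseteq> ?U" using JT False by auto
        have "card ?U < card T" by (rule card_Diff1_less[OF T i])
        then obtain \<alpha> y where \<alpha>: "\<alpha> \<in> lower_along V J ?U" and y: "y \<in> carrier (obj V J)"
          and x_eq: "x = \<alpha> \<otimes>\<^bsub>obj V ?U\<^esub> incl V J ?U y"
          using less.hyps[of ?U] T JU less.prems(3) x by (auto elim!: in_set_multE)
        have \<alpha>c: "\<alpha> \<in> carrier (obj V ?U)"
          using \<alpha> lower_along_subset[OF V, of ?U J] T by blast
        have yc: "incl V J ?U y \<in> carrier (obj V ?U)"
          using incl_closed[OF V _ JU y] T by blast
        have "incl V ?U T x = incl V ?U T \<alpha> \<otimes>\<^bsub>obj V T\<^esub> incl V J T y"
          unfolding x_eq using hom_mult[OF incl_hom(1)[OF V T Diff_subset] \<alpha>c yc]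
            incl_incl[OF V T JU Diff_subset y] by simp
        moreover have "incl V ?U T \<alpha> \<in> ?H"
          by (rule incl_lower_along[OF V T Diff_subset JU \<alpha>])
        ultimately show ?thesis using y by (auto intro: in_set_multI)
      qed
    qed
    finally show ?thesis .
  qed
qed

text \<open>Here the |J|-th derivative vanishes: even its value at the empty set, represented by
  V_J, consists of sums of images from proper subsets of J.\<close>

lemma generated_below_lower_along:
  assumes V: "FI_module V" and g: "generated_below V g" and T: "finite T" and JT: "J \<subseteq> T"
    and c: "g < int (card J)"
  shows "carrier (obj V T) \<subseteq> lower_along V J T"
proof
  fix x assume "x \<in> carrier (obj V T)"
  then have "x \<in> lower_along V J T <#>\<^bsub>obj V T\<^esub> incl V J T ` carrier (obj V J)"
    using generated_below_split[OF V g T JT] c by auto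
  then obtain \<alpha> y where \<alpha>: "\<alpha> \<in> lower_along V J T" and y: "y \<in> carrier (obj V J)"
    and x: "x = \<alpha> \<otimes>\<^bsub>obj V T\<^esub> incl V J T y"
    by (auto elim!: in_set_multE)
  have "y \<in> lower_along V J J"
    using g y c finite_subset[OF JT T] unfolding generated_below_def by blast
  then have "incl V J T y \<in> lower_along V J T"
    by (rule incl_lower_along[OF V T JT order_refl])
  then show "x \<in> lower_along V J T"
    unfolding x by (rule subgroup.m_closed[OF lower_along_subgroup[OF V T] \<alpha>])
qed

text \<open>For \<open>J\<close> of size \<open>j\<close> this says that the \<open>j\<close>-th iterated derivative
  \<open>S \<mapsto> V\<^bsub>S \<union> J\<^esub> / \<Sum>\<^bsub>i \<in> J\<^esub> V\<^bsub>S \<union> J - i\<^esub>\<close> of \<open>V\<close> is torsion-free.\<close>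

definition derivatives_torsion_free :: "'a fin_diagram \<Rightarrow> bool" where
  "derivatives_torsion_free V \<longleftrightarrow>
     (\<forall>T s J v. finite T \<longrightarrow> s \<notin> T \<longrightarrow> J \<subseteq> T \<longrightarrow> v \<in> carrier (obj V T) \<longrightarrow>
        incl V T (insert s T) v \<in> lower_along V J (insert s T) \<longrightarrow> v \<in> lower_along V J T)"

lemma derivatives_torsion_freeD:
  assumes V: "FI_module V" and tf: "derivatives_torsion_free V"
    and "finite T" "S \<subseteq> T" "J \<subseteq> S" "v \<in> carrier (obj V S)" "incl V S T v \<in> lower_along V J T"
  shows "v \<in> lower_along V J S"
  using assms(3-7)
proof (induction "card T" arbitrary: T rule: less_induct)
  case less
  note T = \<open>finite T\<close>
  show ?case
  proof (cases "S = T")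
    case True
    then show ?thesis using less.prems incl_refl[OF V T] by simp
  next
    case False
    then obtain s where s: "s \<in> T" "s \<notin> S" using less.prems(2) by blast
    let ?U = "T - {s}"
    have SU: "S \<subseteq> ?U" using s less.prems(2) by auto
    have fU: "finite ?U" using T by simp
    have ins: "insert s ?U = T" using s by auto
    have "incl V ?U T (incl V S ?U v) \<in> lower_along V J T"
      using incl_incl[OF V T SU Diff_subset less.prems(4)] less.prems(5) by simp
    moreover have "incl V S ?U v \<in> carrier (obj V ?U)"
      by (rule incl_closed[OF V fU SU less.prems(4)])
    moreover have "J \<subseteq> ?U" using less.prems(3) SU by blast
    ultimately have "incl V S ?U v \<in> lower_along V J ?U"
      using tf fU ins unfolding derivatives_torsion_free_def
      by (metis Diff_iff singletonI)
    moreover have "card ?U < card T" by (rule card_Diff1_less[OF T s(1)])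
    ultimately show ?thesis using less.hyps[of ?U] fU SU less.prems(3,4) by blast
  qed
qed

text \<open>The number b is one more than the bound on the degrees of generators of B. It may be 0,
  which means B = 0, and the b-th derivative of B vanishes; the bound a + b + 1 of the overview
  becomes a + b.\<close>

locale FI_map_into_torsion_free =
  fixes A :: "'a fin_diagram" and B :: "'b fin_diagram" and \<phi> and a b :: nat
  assumes A: "FI_module A" and B: "FI_module B" and map: "FI_module_map A B \<phi>"
    and genA: "generated_below A (int a)" and genB: "generated_below B (int b - 1)"
    and tf: "derivatives_torsion_free B"
begin

text \<open>\<open>Z J\<close> modulo \<open>lower_along A J\<close> is the kernel of the map induced by \<open>\<phi>\<close> on the \<open>|J|\<close>-th
  derivatives, and \<open>G J\<close> modulo \<open>lower_along A J\<close> is its part generated in lower degrees.\<close>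

definition Z :: "nat set \<Rightarrow> nat set \<Rightarrow> 'a set" where
  "Z J T = {x \<in> carrier (obj A T). \<phi> T x \<in> lower_along B J T}"

definition G_gens :: "nat set \<Rightarrow> nat set \<Rightarrow> 'a set" where
  "G_gens J T = (\<Union>i\<in>J. incl A (T - {i}) T ` carrier (obj A (T - {i}))) \<union>
     (\<Union>i\<in>T - J. incl A (T - {i}) T ` Z J (T - {i}))"

definition G :: "nat set \<Rightarrow> nat set \<Rightarrow> 'a set" where
  "G J T = generate (obj A T) (G_gens J T)"

lemma Z_subgroup: "finite T \<Longrightarrow> subgroup (Z J T) (obj A T)"
  unfolding Z_def
  by (rule subgroup_preimage[OF FI_module_map_hom[OF A B map] lower_along_subgroup[OF B]])

lemma Z_subset: "Z J T \<subseteq> carrier (obj A T)"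
  by (auto simp: Z_def)

lemma Z_mono: "finite T \<Longrightarrow> J \<subseteq> J' \<Longrightarrow> Z J T \<subseteq> Z J' T"
  using subsetD[OF lower_along_mono[OF B]] by (auto simp: Z_def)

lemma lower_along_Z: "finite T \<Longrightarrow> lower_along A J T \<subseteq> Z J T"
  using subsetD[OF lower_along_subset[OF A]] map_lower_along[OF A B map] by (auto simp: Z_def)

lemma incl_Z:
  assumes "finite T" "S \<subseteq> T" "J \<subseteq> S" "x \<in> Z J S"
  shows "incl A S T x \<in> Z J T"
  using assms incl_closed[OF A assms(1,2)] FI_module_map_incl[OF map assms(1,2)]
    incl_lower_along[OF B assms(1-3)] by (auto simp: Z_def)

text \<open>Torsion-freeness of B enters here: the image of x under the map vanishes in the
  derivative along J after S is enlarged to T, hence it vanished before.\<close>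

lemma incl_ZD:
  assumes "finite T" "S \<subseteq> T" "J \<subseteq> S" "x \<in> carrier (obj A S)" "incl A S T x \<in> Z J T"
  shows "x \<in> Z J S"
proof -
  have "\<phi> S x \<in> carrier (obj B S)"
    by (rule group_hom.hom_closed[OF FI_module_map_hom[OF A B map finite_subset[OF assms(2,1)]] assms(4)])
  then show ?thesis
    using assms derivatives_torsion_freeD[OF B tf assms(1-3)] FI_module_map_incl[OF map assms(1,2,4)]
    by (auto simp: Z_def)
qed

lemma G_gens_subset: "finite T \<Longrightarrow> G_gens J T \<subseteq> carrier (obj A T)"
  using incl_closed[OF A _ Diff_subset] Z_subset unfolding G_gens_def by blast

lemma G_subgroup: "finite T \<Longrightarrow> subgroup (G J T) (obj A T)"
  unfolding G_def
  by (rule group.generate_is_subgroup[OF FI_module_group(2)[OF A] G_gens_subset])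

lemma G_least:
  assumes "finite T" "subgroup H (obj A T)" 
    and "\<And>i x. i \<in> J \<Longrightarrow> x \<in> carrier (obj A (T - {i})) \<Longrightarrow> incl A (T - {i}) T x \<in> H"
    and "\<And>i x. i \<in> T \<Longrightarrow> i \<notin> J \<Longrightarrow> x \<in> Z J (T - {i}) \<Longrightarrow> incl A (T - {i}) T x \<in> H"
  shows "G J T \<subseteq> H"
  unfolding G_def
  by (rule group.generate_subgroup_incl[OF FI_module_group(2)[OF A assms(1)] _ assms(2)])
    (use assms(3,4) in \<open>auto simp: G_gens_def\<close>)

lemma lower_along_G:
  assumes "finite T"
  shows "lower_along A J T \<subseteq> G J T"
  by (rule lower_along_least[OF A assms G_subgroup[OF assms]])
    (auto simp: G_def G_gens_def intro!: generate.incl)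

lemma incl_G:
  "i \<in> T \<Longrightarrow> i \<notin> J \<Longrightarrow> x \<in> Z J (T - {i}) \<Longrightarrow> incl A (T - {i}) T x \<in> G J T"
  by (auto simp: G_def G_gens_def intro!: generate.incl)

lemma G_Z:
  assumes "finite T" "J \<subseteq> T"
  shows "G J T \<subseteq> Z J T"
proof (rule G_least[OF assms(1) Z_subgroup[OF assms(1)]])
  fix i x assume "i \<in> J" "x \<in> carrier (obj A (T - {i}))"
  then show "incl A (T - {i}) T x \<in> Z J T"
    by (intro subsetD[OF lower_along_Z[OF assms(1)]] incl_in_lower_along[OF A assms(1) Diff_subset]) auto
next
  fix i x assume "i \<in> T" "i \<notin> J" "x \<in> Z J (T - {i})"
  then show "incl A (T - {i}) T x \<in> Z J T"
    using assms by (intro incl_Z) auto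
qed

text \<open>This is the vanishing of the action of \<open>U - {i} \<subseteq> U\<close> on the torsion of the cokernel of \<open>\<phi>\<close>: the
  bijection \<open>U - {i} \<rightarrow> U - {s}\<close> that sends \<open>s\<close> to \<open>i\<close> turns the inclusion of a new point \<open>i\<close> into
  that of \<open>s\<close>, whose effect is trivial by assumption.\<close>

lemma incl_Z_exchange:
  assumes U: "finite U" and J: "J \<subseteq> U" and s: "s \<in> U" "s \<notin> J" and i: "i \<in> U" "i \<notin> insert s J"
    and y: "y \<in> Z (insert s J) (U - {i})"
  shows "incl A (U - {i}) U y \<in> Z J U <#>\<^bsub>obj A U\<^esub> incl A (U - {s}) U ` carrier (obj A (U - {s}))"
proof -
  let ?Ui = "U - {i}" and ?Us = "U - {s}" and ?R = "U - {i} - {s}"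
  have f: "finite ?Ui" "finite ?Us" "finite ?R" using U by auto
  have RUs: "?R \<subseteq> ?Us" by auto
  interpret AU: comm_group "obj A U" by (rule FI_module_group(1)[OF A U])
  interpret BU: comm_group "obj B U" by (rule FI_module_group(1)[OF B U])
  interpret Bi: comm_group "obj B ?Ui" by (rule FI_module_group(1)[OF B f(1)])
  interpret \<phi>U: group_hom "obj A U" "obj B U" "\<phi> U" by (rule FI_module_map_hom[OF A B map U])
  define \<tau> where "\<tau> = (\<lambda>x\<in>?Ui. if x = s then i else x)"
  have \<tau>: "\<tau> \<in> FI_mor ?Ui ?Us"
    using s i by (auto simp: \<tau>_def FI_mor_def inj_on_def)
  have \<tau>J: "\<tau> ` J = J"
    using J s i by (auto simp: \<tau>_def image_iff)
  have \<tau>R: "restrict \<tau> ?R = (\<lambda>x\<in>?R. x)"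
    by (auto simp: \<tau>_def fun_eq_iff)
  have JUi: "J \<subseteq> ?Ui" and JUs: "J \<subseteq> ?Us" using J s i by auto
  have yc: "y \<in> carrier (obj A ?Ui)" using y by (simp add: Z_def)
  note subs = lower_along_subgroup[OF B f(1), of J] incl_image_subgroup[OF B f(1), of ?R]
  \<comment> \<open>Modulo the part along J, what remains of the value of B comes from U - {i} -
    {s}. This isolates a part that \<open>\<tau>\<close> does not move.\<close>
  have "lower_along B (insert s J) ?Ui \<subseteq>
      lower_along B J ?Ui <#>\<^bsub>obj B ?Ui\<^esub> incl B ?R ?Ui ` carrier (obj B ?R)"
  proof (rule lower_along_least[OF B f(1)])
    show "subgroup (lower_along B J ?Ui <#>\<^bsub>obj B ?Ui\<^esub> incl B ?R ?Ui ` carrier (obj B ?R)) (obj B ?Ui)"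
      using subs by (intro Bi.mult_subgroups) auto
    fix k x assume k: "k \<in> insert s J" and x: "x \<in> carrier (obj B (?Ui - {k}))"
    show "incl B (?Ui - {k}) ?Ui x \<in>
        lower_along B J ?Ui <#>\<^bsub>obj B ?Ui\<^esub> incl B ?R ?Ui ` carrier (obj B ?R)"
    proof (cases "k = s")
      case True
      then show ?thesis
        using x subs by (intro subsetD[OF Bi.set_mult_upper2]) auto
    next
      case False
      then have "k \<in> J" using k by simp
      then show ?thesis
        using x subs by (intro subsetD[OF Bi.set_mult_upper1] incl_in_lower_along[OF B f(1), of _ k]) auto
    qed
  qed
  then obtain \<beta> \<gamma> where \<beta>: "\<beta> \<in> lower_along B J ?Ui" and \<gamma>: "\<gamma> \<in> carrier (obj B ?R)"
    and \<phi>y: "\<phi> ?Ui y = \<beta> \<otimes>\<^bsub>obj B ?Ui\<^esub> incl B ?R ?Ui \<gamma>"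
    using y by (auto simp: Z_def elim!: in_set_multE)
  have \<beta>c: "\<beta> \<in> carrier (obj B ?Ui)" using \<beta> lower_along_subset[OF B f(1)] by blast
  have \<gamma>c: "incl B ?R ?Ui \<gamma> \<in> carrier (obj B ?Ui)"
    by (rule incl_closed[OF B f(1) Diff_subset \<gamma>])
  define y' where "y' = mor A ?Ui ?Us \<tau> y"
  have y': "y' \<in> carrier (obj A ?Us)"
    unfolding y'_def by (rule hom_in_carrier[OF FI_module_hom(1)[OF A f(1,2) \<tau>] yc])
  define \<beta>' where "\<beta>' = mor B ?Ui ?Us \<tau> \<beta>"
  have \<beta>': "\<beta>' \<in> lower_along B J ?Us"
    using mor_lower_along[OF B f(1,2) \<tau> JUi \<beta>] \<tau>J by (simp add: \<beta>'_def)
  have \<beta>'c: "\<beta>' \<in> carrier (obj B ?Us)" using \<beta>' lower_along_subset[OF B f(2)] by blast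
  have \<gamma>'c: "incl B ?R ?Us \<gamma> \<in> carrier (obj B ?Us)"
    by (rule incl_closed[OF B f(2) RUs \<gamma>])
  have "\<phi> ?Us y' = mor B ?Ui ?Us \<tau> (\<phi> ?Ui y)"
    using map f \<tau> yc by (simp add: y'_def FI_module_map_def)
  also have "\<dots> = \<beta>' \<otimes>\<^bsub>obj B ?Us\<^esub> mor B ?Ui ?Us \<tau> (incl B ?R ?Ui \<gamma>)"
    unfolding \<phi>y \<beta>'_def by (rule hom_mult[OF FI_module_hom(1)[OF B f(1,2) \<tau>] \<beta>c \<gamma>c])
  also have "mor B ?Ui ?Us \<tau> (incl B ?R ?Ui \<gamma>) = incl B ?R ?Us \<gamma>"
    using mor_incl[OF B f(1,2) \<tau> Diff_subset \<gamma>] by (simp only: \<tau>R incl_def)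
  finally have \<phi>y': "\<phi> ?Us y' = \<beta>' \<otimes>\<^bsub>obj B ?Us\<^esub> incl B ?R ?Us \<gamma>" .
  \<comment> \<open>Both images carry the same factor c, since \<open>\<tau>\<close> is the identity
    on U - {i} - {s}. It cancels in the quotient of u by v below, which leaves p and q, both along
    J.\<close>
  define p q c where "p = incl B ?Ui U \<beta>" and "q = incl B ?Us U \<beta>'" and "c = incl B ?R U \<gamma>"
  have p: "p \<in> lower_along B J U"
    unfolding p_def by (rule incl_lower_along[OF B U Diff_subset JUi \<beta>])
  have q: "q \<in> lower_along B J U"
    unfolding q_def by (rule incl_lower_along[OF B U Diff_subset JUs \<beta>'])
  have pq: "p \<in> carrier (obj B U)" "q \<in> carrier (obj B U)"
    using p q lower_along_subset[OF B U] by blast+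
  have c: "c \<in> carrier (obj B U)"
    unfolding c_def using \<gamma> by (intro incl_closed[OF B U]) auto
  have "\<phi> U (incl A ?Ui U y) = incl B ?Ui U (\<phi> ?Ui y)"
    by (rule FI_module_map_incl[OF map U Diff_subset yc])
  also have "\<dots> = p \<otimes>\<^bsub>obj B U\<^esub> c"
    unfolding \<phi>y p_def c_def hom_mult[OF incl_hom(1)[OF B U Diff_subset] \<beta>c \<gamma>c]
      incl_incl[OF B U Diff_subset Diff_subset \<gamma>] ..
  finally have e1: "\<phi> U (incl A ?Ui U y) = p \<otimes>\<^bsub>obj B U\<^esub> c" .
  have "\<phi> U (incl A ?Us U y') = incl B ?Us U (\<phi> ?Us y')"
    by (rule FI_module_map_incl[OF map U Diff_subset y'])
  also have "\<dots> = q \<otimes>\<^bsub>obj B U\<^esub> c"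
    unfolding \<phi>y' q_def c_def hom_mult[OF incl_hom(1)[OF B U Diff_subset] \<beta>'c \<gamma>'c]
      incl_incl[OF B U RUs Diff_subset \<gamma>] ..
  finally have e2: "\<phi> U (incl A ?Us U y') = q \<otimes>\<^bsub>obj B U\<^esub> c" .
  define u v where "u = incl A ?Ui U y" and "v = incl A ?Us U y'"
  have uv: "u \<in> carrier (obj A U)" "v \<in> carrier (obj A U)"
    unfolding u_def v_def by (rule incl_closed[OF A U Diff_subset yc], rule incl_closed[OF A U Diff_subset y'])
  have "\<phi> U (u \<otimes>\<^bsub>obj A U\<^esub> inv\<^bsub>obj A U\<^esub> v) = (p \<otimes>\<^bsub>obj B U\<^esub> c) \<otimes>\<^bsub>obj B U\<^esub> inv\<^bsub>obj B U\<^esub> (q \<otimes>\<^bsub>obj B U\<^esub> c)"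
    using uv e1 e2 by (simp add: u_def v_def)
  also have "\<dots> = p \<otimes>\<^bsub>obj B U\<^esub> inv\<^bsub>obj B U\<^esub> q"
  proof -
    have "c \<otimes>\<^bsub>obj B U\<^esub> inv\<^bsub>obj B U\<^esub> (q \<otimes>\<^bsub>obj B U\<^esub> c) = inv\<^bsub>obj B U\<^esub> q"
      using pq c by (simp add: BU.inv_mult BU.m_lcomm[of c] BU.r_inv)
    then show ?thesis
      using pq c by (simp add: BU.m_assoc)
  qed
  finally have "\<phi> U (u \<otimes>\<^bsub>obj A U\<^esub> inv\<^bsub>obj A U\<^esub> v) \<in> lower_along B J U"
    using subgroup.m_closed[OF lower_along_subgroup[OF B U] p
        subgroup.m_inv_closed[OF lower_along_subgroup[OF B U] q]] by simp
  then have "u \<otimes>\<^bsub>obj A U\<^esub> inv\<^bsub>obj A U\<^esub> v \<in> Z J U"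
    using uv by (simp add: Z_def)
  moreover have "v \<in> incl A ?Us U ` carrier (obj A ?Us)"
    using y' by (simp add: v_def)
  ultimately have "u \<otimes>\<^bsub>obj A U\<^esub> inv\<^bsub>obj A U\<^esub> v \<otimes>\<^bsub>obj A U\<^esub> v \<in>
      Z J U <#>\<^bsub>obj A U\<^esub> incl A ?Us U ` carrier (obj A ?Us)"
    by (rule in_set_multI)
  then show ?thesis
    using uv by (simp add: AU.m_assoc u_def)
qed

text \<open>At |J| = a the derivative of A is generated at the empty set, so modulo the part along J
  an element of the kernel comes from some y in A_J. Torsion-freeness of B puts y into the kernel
  already over J, and |T| > |J| leaves a point i outside J, so that y can be passed through T -
  {i}.\<close>

lemma Z_subset_G_base_a:
  assumes T: "finite T" and JT: "J \<subseteq> T" and J: "card J = a" and c: "a < card T"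
  shows "Z J T \<subseteq> G J T"
proof
  fix x assume x: "x \<in> Z J T"
  interpret AT: comm_group "obj A T" by (rule FI_module_group(1)[OF A T])
  have "x \<in> lower_along A J T <#>\<^bsub>obj A T\<^esub> incl A J T ` carrier (obj A J)"
    using generated_below_split[OF A genA T JT] J x Z_subset by auto
  then obtain \<alpha> y where \<alpha>: "\<alpha> \<in> lower_along A J T" and y: "y \<in> carrier (obj A J)"
    and x_eq: "x = \<alpha> \<otimes>\<^bsub>obj A T\<^esub> incl A J T y"
    by (auto elim!: in_set_multE)
  have \<alpha>Z: "\<alpha> \<in> Z J T" using \<alpha> lower_along_Z[OF T] by blast
  have yc: "incl A J T y \<in> carrier (obj A T)" by (rule incl_closed[OF A T JT y])
  have "incl A J T y \<in> Z J T"
    by (rule AT.subgroup_cancel_left[OF Z_subgroup[OF T] \<alpha>Z x[unfolded x_eq] yc])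
  then have yZ: "y \<in> Z J J"
    by (rule incl_ZD[OF T JT order_refl y])
  have "J \<noteq> T" using J c by auto
  then obtain i where i: "i \<in> T" "i \<notin> J" using JT by blast
  have Ji: "J \<subseteq> T - {i}" using JT i by auto
  have "incl A J (T - {i}) y \<in> Z J (T - {i})"
    using T by (intro incl_Z[OF _ Ji order_refl yZ]) auto
  then have "incl A (T - {i}) T (incl A J (T - {i}) y) \<in> G J T"
    by (rule incl_G[OF i])
  then have "incl A J T y \<in> G J T"
    using incl_incl[OF A T Ji Diff_subset y] by simp
  then show "x \<in> G J T"
    unfolding x_eq using \<alpha> lower_along_G[OF T] subgroup.m_closed[OF G_subgroup[OF T]] by blast
qed

text \<open>At |J| = b the derivative of B is zero, so over sets containing J the group
  \<open>Z J\<close> is all of A, and it suffices that A is generated in degrees at most a.\<close>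

lemma Z_subset_G_base_b:
  assumes T: "finite T" and JT: "J \<subseteq> T" and J: "card J = b" and c: "a < card T"
  shows "Z J T \<subseteq> G J T"
proof -
  have "carrier (obj A T) \<subseteq> lower_along A T T"
    using genA T c unfolding generated_below_def by simp
  also have "\<dots> \<subseteq> G J T"
  proof (rule lower_along_least[OF A T G_subgroup[OF T]])
    fix i x assume i: "i \<in> T" and x: "x \<in> carrier (obj A (T - {i}))"
    show "incl A (T - {i}) T x \<in> G J T"
    proof (cases "i \<in> J")
      case True
      then show ?thesis using x by (auto simp: G_def G_gens_def intro!: generate.incl)
    next
      case False
      have fi: "finite (T - {i})" using T by simp
      have "carrier (obj B (T - {i})) \<subseteq> lower_along B J (T - {i})"
        using JT False J by (intro generated_below_lower_along[OF B genB fi]) auto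
      moreover have "\<phi> (T - {i}) x \<in> carrier (obj B (T - {i}))"
        by (rule group_hom.hom_closed[OF FI_module_map_hom[OF A B map fi] x])
      ultimately have "x \<in> Z J (T - {i})" using x by (auto simp: Z_def)
      then show ?thesis by (rule incl_G[OF i False])
    qed
  qed
  finally show ?thesis using Z_subset by blast
qed

text \<open>For the |J|-th derivative, whose argument is T - J, the last condition says that |T - J|
  exceeds min (2 * a) (a + b) - 2 * |J|. The induction enlarges J until |J| = min a b, where one of
  the two base cases applies.\<close>

lemma Z_subset_G:
  assumes "finite T" "J \<subseteq> T" "card J \<le> min a b" "min (2 * a) (a + b) < card T + card J"
  shows "Z J T \<subseteq> G J T"
  using assms
proof (induction "min a b - card J" arbitrary: J T)
  case 0
  then consider "card J = a" "a \<le> b" | "card J = b" "b \<le> a" by linarith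
  then show ?case
  proof cases
    case 1
    then show ?thesis using 0 by (intro Z_subset_G_base_a) auto
  next
    case 2
    then show ?thesis using 0 by (intro Z_subset_G_base_b) auto
  qed
next
  case (Suc m)
  note T = \<open>finite T\<close> and JT = \<open>J \<subseteq> T\<close>
  interpret AT: comm_group "obj A T" by (rule FI_module_group(1)[OF A T])
  \<comment> \<open>Otherwise |T| + |J| = 2 * |J| < 2 * min a b, and this is at most min (2 * a) (a
    + b).\<close>
  have "J \<noteq> T" using Suc.hyps(2) Suc.prems(4) by auto
  then obtain s where s: "s \<in> T" "s \<notin> J" using JT by blast
  let ?J = "insert s J"
  have cJ: "card ?J = Suc (card J)"
    using s finite_subset[OF JT T] by simp
  \<comment> \<open>Since \<open>?J\<close> has one point more than J, the bound still holds when T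
    loses a point. The hypothesis is used at T and at each T - {i}.\<close>
  have IH: "Z ?J U \<subseteq> G ?J U" if "finite U" "?J \<subseteq> U" "card T \<le> Suc (card U)" for U
    using that Suc.hyps(2) Suc.prems(4) cJ by (intro Suc.hyps(1)) auto
  let ?As = "\<lambda>U. incl A (U - {s}) U ` carrier (obj A (U - {s}))"
  have sgA: "subgroup (?As U) (obj A U)" if "finite U" for U
    by (rule incl_image_subgroup[OF A that Diff_subset])
  \<comment> \<open>The product of \<open>Z J U\<close> and \<open>?As U\<close> represents the
    derivative of the kernel, inside the kernel of the derivatives. By
    \<open>incl_Z_exchange\<close>, proper inclusions carry the larger group into the smaller
    one.\<close>
  have up: "G ?J U \<subseteq> Z J U <#>\<^bsub>obj A U\<^esub> ?As U" if U: "finite U" and JU: "?J \<subseteq> U" for U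
  proof -
    interpret AU: comm_group "obj A U" by (rule FI_module_group(1)[OF A U])
    note subs = Z_subgroup[OF U, of J] sgA[OF U]
    show ?thesis
    proof (rule G_least[OF U AU.mult_subgroups[OF subs]])
      fix i x assume i: "i \<in> ?J" and x: "x \<in> carrier (obj A (U - {i}))"
      show "incl A (U - {i}) U x \<in> Z J U <#>\<^bsub>obj A U\<^esub> ?As U"
      proof (cases "i = s")
        case True
        then show ?thesis using x by (intro subsetD[OF AU.set_mult_upper2[OF subs]]) auto
      next
        case False
        then have "i \<in> J" using i by simp
        then show ?thesis
          using x by (intro subsetD[OF AU.set_mult_upper1[OF subs]] subsetD[OF lower_along_Z[OF U]]
              incl_in_lower_along[OF A U Diff_subset, of i]) auto
      qed
    next
      fix i x assume "i \<in> U" "i \<notin> ?J" "x \<in> Z ?J (U - {i})"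
      then show "incl A (U - {i}) U x \<in> Z J U <#>\<^bsub>obj A U\<^esub> ?As U"
        using JU s by (intro incl_Z_exchange[OF U]) auto
    qed
  qed
  note subs = G_subgroup[OF T, of J] sgA[OF T]
  \<comment> \<open>Over T - {i} the induction hypothesis and \<open>up\<close> give z a factor in
    \<open>Z J (T - {i})\<close>, whose image in T is a generator of \<open>G J T\<close>. The other
    factor comes from a set without s.\<close>
  have main: "G ?J T \<subseteq> G J T <#>\<^bsub>obj A T\<^esub> ?As T"
  proof (rule G_least[OF T AT.mult_subgroups[OF subs]])
    fix i x assume i: "i \<in> ?J" and x: "x \<in> carrier (obj A (T - {i}))"
    show "incl A (T - {i}) T x \<in> G J T <#>\<^bsub>obj A T\<^esub> ?As T"
    proof (cases "i = s")
      case True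
      then show ?thesis using x by (intro subsetD[OF AT.set_mult_upper2[OF subs]]) auto
    next
      case False
      then have "i \<in> J" using i by simp
      then show ?thesis
        using x by (intro subsetD[OF AT.set_mult_upper1[OF subs]] subsetD[OF lower_along_G[OF T]]
            incl_in_lower_along[OF A T Diff_subset, of i]) auto
    qed
  next
    fix i z assume i: "i \<in> T" "i \<notin> ?J" and z: "z \<in> Z ?J (T - {i})"
    let ?U = "T - {i}"
    have U: "finite ?U" and JU: "?J \<subseteq> ?U" and cU: "card T \<le> Suc (card ?U)"
      using T JT s i by (auto simp: card_Diff_singleton_if)
    obtain \<zeta> \<beta> where \<zeta>: "\<zeta> \<in> Z J ?U" and \<beta>: "\<beta> \<in> carrier (obj A (?U - {s}))"
      and z_eq: "z = \<zeta> \<otimes>\<^bsub>obj A ?U\<^esub> incl A (?U - {s}) ?U \<beta>"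
      using z IH[OF U JU cU] up[OF U JU] by (auto elim!: in_set_multE dest!: subsetD)
    have \<zeta>c: "\<zeta> \<in> carrier (obj A ?U)" using \<zeta> Z_subset by blast
    have \<beta>c: "incl A (?U - {s}) ?U \<beta> \<in> carrier (obj A ?U)"
      by (rule incl_closed[OF A U Diff_subset \<beta>])
    have Us: "?U - {s} \<subseteq> T - {s}" by auto
    have "incl A ?U T z = incl A ?U T \<zeta> \<otimes>\<^bsub>obj A T\<^esub> incl A (?U - {s}) T \<beta>"
      unfolding z_eq hom_mult[OF incl_hom(1)[OF A T Diff_subset] \<zeta>c \<beta>c]
        incl_incl[OF A T Diff_subset Diff_subset \<beta>] ..
    also have "incl A (?U - {s}) T \<beta> = incl A (T - {s}) T (incl A (?U - {s}) (T - {s}) \<beta>)"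
      by (rule incl_incl[OF A T Us Diff_subset \<beta>, symmetric])
    finally have "incl A ?U T z = incl A ?U T \<zeta> \<otimes>\<^bsub>obj A T\<^esub>
        incl A (T - {s}) T (incl A (?U - {s}) (T - {s}) \<beta>)" .
    moreover have "incl A ?U T \<zeta> \<in> G J T"
      using i by (intro incl_G[OF _ _ \<zeta>]) auto
    moreover have "incl A (?U - {s}) (T - {s}) \<beta> \<in> carrier (obj A (T - {s}))"
      using T by (intro incl_closed[OF A _ Us \<beta>]) auto
    ultimately show "incl A ?U T z \<in> G J T <#>\<^bsub>obj A T\<^esub> ?As T"
      by (auto intro: in_set_multI)
  qed
  show ?case
  proof
    fix x assume x: "x \<in> Z J T"
    have "x \<in> Z ?J T" using Z_mono[OF T, of J ?J] x by blast
    then have "x \<in> G J T <#>\<^bsub>obj A T\<^esub> ?As T"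
      using IH[of T] main T JT s by auto
    then obtain \<alpha> \<beta> where \<alpha>: "\<alpha> \<in> G J T" and \<beta>: "\<beta> \<in> carrier (obj A (T - {s}))"
      and x_eq: "x = \<alpha> \<otimes>\<^bsub>obj A T\<^esub> incl A (T - {s}) T \<beta>"
      by (auto elim!: in_set_multE)
    have \<alpha>Z: "\<alpha> \<in> Z J T" using \<alpha> G_Z[OF T JT] by blast
    have \<beta>c: "incl A (T - {s}) T \<beta> \<in> carrier (obj A T)"
      by (rule incl_closed[OF A T Diff_subset \<beta>])
    \<comment> \<open>The first factor lies in \<open>Z J T\<close>, hence so does the second. As
      this one comes from T - {s}, torsion-freeness makes it a generator of
      \<open>G J T\<close>.\<close>
    have "incl A (T - {s}) T \<beta> \<in> Z J T"
      by (rule AT.subgroup_cancel_left[OF Z_subgroup[OF T] \<alpha>Z x[unfolded x_eq] \<beta>c])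
    then have "\<beta> \<in> Z J (T - {s})"
      using JT s by (intro incl_ZD[OF T Diff_subset _ \<beta>]) auto
    then have "incl A (T - {s}) T \<beta> \<in> G J T"
      by (rule incl_G[OF s])
    then show "x \<in> G J T"
      unfolding x_eq using \<alpha> subgroup.m_closed[OF G_subgroup[OF T]] by blast
  qed
qed

end

subsection \<open>Purity\<close>

text \<open>Subgroups of one ambient additive type: the values of P_0 at different sets lie in a
  single type of formal sums, so subgroups over different sets can be compared and added
  directly.\<close>

definition diff_closed :: "'b::ab_group_add set \<Rightarrow> bool" where
  "diff_closed M \<longleftrightarrow> 0 \<in> M \<and> (\<forall>x\<in>M. \<forall>y\<in>M. x - y \<in> M)"

lemma diff_closedD:
  assumes "diff_closed M"
  shows "0 \<in> M" "x \<in> M \<Longrightarrow> y \<in> M \<Longrightarrow> x - y \<in> M"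
    "x \<in> M \<Longrightarrow> - x \<in> M" "x \<in> M \<Longrightarrow> y \<in> M \<Longrightarrow> x + y \<in> M"
proof -
  show *: "0 \<in> M" "x \<in> M \<Longrightarrow> y \<in> M \<Longrightarrow> x - y \<in> M" for x y
    using assms by (auto simp: diff_closed_def)
  show neg: "- x \<in> M" if "x \<in> M" for x
    using *(2)[OF *(1) that] by simp
  show "x + y \<in> M" if "x \<in> M" "y \<in> M"
    using *(2)[OF that(1) neg[OF that(2)]] by simp
qed

lemma diff_closed_sum:
  assumes "diff_closed M" "\<And>i. i \<in> F \<Longrightarrow> \<kappa> i \<in> M"
  shows "sum \<kappa> F \<in> M"
  using assms(2)
  by (induction F rule: infinite_finite_induct) (auto simp: diff_closedD[OF assms(1)])

definition family_sum :: "'i set \<Rightarrow> ('i \<Rightarrow> 'b::ab_group_add set) \<Rightarrow> 'b set" where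
  "family_sum F K = {sum \<kappa> F | \<kappa>. \<forall>i\<in>F. \<kappa> i \<in> K i}"

lemma diff_closed_family_sum:
  assumes "\<And>i. i \<in> F \<Longrightarrow> diff_closed (K i)"
  shows "diff_closed (family_sum F K)"
  unfolding diff_closed_def
proof (intro conjI ballI)
  show "0 \<in> family_sum F K"
    unfolding family_sum_def using diff_closedD(1)[OF assms]
    by (auto intro!: exI[of _ "\<lambda>_. 0"])
  fix x y assume "x \<in> family_sum F K" "y \<in> family_sum F K"
  then obtain \<kappa> \<mu> where "x = sum \<kappa> F" "y = sum \<mu> F" "\<forall>i\<in>F. \<kappa> i \<in> K i" "\<forall>i\<in>F. \<mu> i \<in> K i"
    unfolding family_sum_def by auto
  then show "x - y \<in> family_sum F K"
    unfolding family_sum_def using diff_closedD(2)[OF assms]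
    by (auto intro!: exI[of _ "\<lambda>i. \<kappa> i - \<mu> i"] simp: sum_subtractf)
qed

lemma family_sum_upper:
  assumes "finite F" "\<And>i. i \<in> F \<Longrightarrow> diff_closed (K i)" "i \<in> F" "x \<in> K i"
  shows "x \<in> family_sum F K"
  unfolding family_sum_def using assms diff_closedD(1)[OF assms(2)]
  by (auto intro!: exI[of _ "\<lambda>j. if j = i then x else 0"])

lemma family_sum_least:
  assumes "diff_closed M" "\<And>i. i \<in> F \<Longrightarrow> K i \<subseteq> M"
  shows "family_sum F K \<subseteq> M"
  unfolding family_sum_def using assms by (auto intro!: diff_closed_sum)

text \<open>Purity for the full set of indices propagates to every subset \<open>J\<close>: writing an element as a
  sum over sets \<open>R\<close>, the terms with \<open>J \<subseteq> R\<close> of maximal size have no component of support exactly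
  \<open>R\<close>, since nothing could cancel it, so that purity moves them to smaller sets.\<close>

lemma purity_along:
  fixes K :: "nat set \<Rightarrow> ('g \<Rightarrow>\<^sub>0 int) set" and \<sigma> :: "'g \<Rightarrow> nat set"
  assumes T: "finite T" and K: "\<And>R. R \<subseteq> T \<Longrightarrow> diff_closed (K R)"
    and mono: "\<And>R R'. R \<subseteq> R' \<Longrightarrow> R' \<subseteq> T \<Longrightarrow> K R \<subseteq> K R'"
    and supp: "\<And>R x e. R \<subseteq> T \<Longrightarrow> x \<in> K R \<Longrightarrow> e \<in> Poly_Mapping.keys x \<Longrightarrow> \<sigma> e \<subseteq> R"
    and pure: "\<And>R x. R \<subseteq> T \<Longrightarrow> x \<in> K R \<Longrightarrow> \<forall>e\<in>Poly_Mapping.keys x. \<sigma> e \<noteq> R \<Longrightarrow>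
      x \<in> family_sum R (\<lambda>i. K (R - {i}))"
    and J: "J \<subseteq> T" and x: "x \<in> K T" and xJ: "\<forall>e\<in>Poly_Mapping.keys x. \<not> J \<subseteq> \<sigma> e"
  shows "x \<in> family_sum J (\<lambda>i. K (T - {i}))"
proof -
  \<comment> \<open>B is the family of sets aimed at. The terms over sets containing J that are
    still to be removed lie in A n; the bound n on their sizes drops from card T + 1, which admits T
    itself, to 0, where A n is empty.\<close>
  define B where "B = (\<lambda>i. T - {i}) ` J"
  define A where "A n = {R. J \<subseteq> R \<and> R \<subseteq> T \<and> card R < n}" for n
  have sub: "R \<subseteq> T" if "R \<in> B \<union> A n" for R n
    using that by (auto simp: A_def B_def)
  have fin: "finite (B \<union> A n)" for n
    by (rule finite_subset[of _ "Pow T"]) (use sub T in auto)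
  have dc: "diff_closed (K R)" if "R \<in> B \<union> A n" for R n
    using K sub[OF that] by blast
  have dcM: "diff_closed (family_sum (B \<union> A n) K)" for n
    by (rule diff_closed_family_sum) (rule dc)
  have upper: "K R \<subseteq> family_sum (B \<union> A n) K" if "R \<in> B \<union> A n" for R n
    by (rule subsetI, rule family_sum_upper[OF fin _ that]) (rule dc)
  have step: "x \<in> family_sum (B \<union> A n) K" if xn: "x \<in> family_sum (B \<union> A (Suc n)) K" for n
  proof -
    let ?F = "B \<union> A (Suc n)"
    obtain \<kappa> where x_eq: "x = sum \<kappa> ?F" and \<kappa>: "\<And>R. R \<in> ?F \<Longrightarrow> \<kappa> R \<in> K R"
      using xn unfolding family_sum_def by auto
    have "\<kappa> R \<in> family_sum (B \<union> A n) K" if R: "R \<in> ?F" for R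
    proof (cases "R \<in> B \<union> A n")
      case True
      then show ?thesis using upper \<kappa>[OF R] by blast
    next
      case False
      then have JR: "J \<subseteq> R" and RT: "R \<subseteq> T" and cR: "card R = n"
        using R by (auto simp: A_def)
      have finR: "finite R" using RT T by (rule finite_subset)
      have "\<sigma> e \<noteq> R" if e: "e \<in> Poly_Mapping.keys (\<kappa> R)" for e
      proof
        assume eR: "\<sigma> e = R"
        \<comment> \<open>A term in which e occurs is indexed by a set containing R. Sets in B miss
          a point of J, and a set in A (Suc n) has size at most n = card R, so it would equal
          R.\<close>
        have "Poly_Mapping.lookup (\<kappa> R') e = 0" if R': "R' \<in> ?F" "R' \<noteq> R" for R'
        proof (rule ccontr)
          assume "Poly_Mapping.lookup (\<kappa> R') e \<noteq> 0"
          then have RR': "R \<subseteq> R'"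
            using supp[OF sub[OF R'(1)] \<kappa>[OF R'(1)]] eR by (auto simp: in_keys_iff)
          show False
          proof (cases "R' \<in> B")
            case True
            then show ?thesis using JR RR' by (auto simp: B_def)
          next
            case False
            then have "R' \<subseteq> T" "card R' \<le> n" using R'(1) by (auto simp: A_def)
            then show ?thesis
              using card_seteq[OF finite_subset[OF _ T] RR'] R'(2) cR by auto
          qed
        qed
        then have "(\<Sum>R'\<in>?F - {R}. Poly_Mapping.lookup (\<kappa> R') e) = 0"
          by (intro sum.neutral) auto
        then have "Poly_Mapping.lookup x e = Poly_Mapping.lookup (\<kappa> R) e"
          unfolding x_eq lookup_sum by (simp add: sum.remove[OF fin R])
        moreover have "Poly_Mapping.lookup x e = 0"
          using xJ JR eR by (auto simp: in_keys_iff)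
        ultimately show False using e by (simp add: in_keys_iff)
      qed
      then have \<kappa>R: "\<kappa> R \<in> family_sum R (\<lambda>i. K (R - {i}))"
        using pure[OF RT \<kappa>[OF R]] by blast
      \<comment> \<open>The sets that purity produces are admissible: for i in J they lie in T -
        {i}, otherwise they still contain J and have fewer than n points.\<close>
      have "K (R - {i}) \<subseteq> family_sum (B \<union> A n) K" if i: "i \<in> R" for i
      proof (cases "i \<in> J")
        case True
        have "K (R - {i}) \<subseteq> K (T - {i})" using RT by (intro mono) auto
        then show ?thesis using upper[of "T - {i}" n] True by (auto simp: B_def)
      next
        case False
        have "card (R - {i}) < n" using card_Diff1_less[OF finR i] cR by simp
        then have "R - {i} \<in> A n" using JR RT False by (auto simp: A_def)
        then show ?thesis by (intro upper) simp
      qed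
      then have "family_sum R (\<lambda>i. K (R - {i})) \<subseteq> family_sum (B \<union> A n) K"
        by (rule family_sum_least[OF dcM])
      with \<kappa>R show ?thesis by (rule rev_subsetD)
    qed
    then show ?thesis unfolding x_eq by (rule diff_closed_sum[OF dcM])
  qed
  have "x \<in> family_sum (B \<union> A 0) K" if "x \<in> family_sum (B \<union> A n) K" for n
    using that by (induction n) (use step in auto)
  moreover have "x \<in> family_sum (B \<union> A (Suc (card T))) K"
    using upper[of T "Suc (card T)"] x J by (auto simp: A_def)
  ultimately have "x \<in> family_sum B K" by (auto simp: A_def)
  then obtain \<kappa> where "x = sum \<kappa> B" "\<forall>R\<in>B. \<kappa> R \<in> K R"
    unfolding family_sum_def by auto
  moreover have "inj_on (\<lambda>i. T - {i}) J" using J by (auto simp: inj_on_def)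
  ultimately show ?thesis
    unfolding family_sum_def B_def by (auto simp: sum.reindex intro!: exI[of _ "\<lambda>i. \<kappa> (T - {i})"])
qed

subsection \<open>The first steps of the standard resolution\<close>

definition gens :: "(nat set \<Rightarrow> 'b set) \<Rightarrow> nat set \<Rightarrow> 'b gen set" where
  "gens X T = {(S, f, x). finite S \<and> f \<in> FI_mor S T \<and> x \<in> X S}"

lemma obj_free_FI: "obj (free_FI X) T = free_Abelian_group (gens X T)"
  by (simp add: free_FI_def gens_def)

lemma FI_mor_mono: "f \<in> FI_mor S T \<Longrightarrow> T \<subseteq> U \<Longrightarrow> f \<in> FI_mor S U"
  by (auto simp: FI_mor_def PiE_iff)

lemma FI_mor_compose: "f \<in> FI_mor S T \<Longrightarrow> g \<in> FI_mor T U \<Longrightarrow> compose S g f \<in> FI_mor S U"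
  by (auto simp: FI_mor_def compose_def inj_on_def PiE_iff)

lemma gens_mono: "T \<subseteq> U \<Longrightarrow> gens X T \<subseteq> gens X U"
  using FI_mor_mono by (fastforce simp: gens_def)

lemma push_frag_of: "push g (frag_of (S, f, x)) = frag_of (S, compose S g f, x)"
  by (simp add: push_def)

lemma push_diff: "push g (c - d) = push g c - push g d"
  by (simp add: push_def frag_extend_diff)

lemma push_0 [simp]: "push g 0 = 0"
  by (simp add: push_def)

lemma keys_push:
  assumes "g \<in> FI_mor T U" "Poly_Mapping.keys c \<subseteq> gens X T"
  shows "Poly_Mapping.keys (push g c) \<subseteq> gens X U"
proof -
  have "Poly_Mapping.keys (push g c) \<subseteq>
      (\<Union>e\<in>Poly_Mapping.keys c. Poly_Mapping.keys (case e of (S, f, x) \<Rightarrow> frag_of (S, compose S g f, x)))"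
    unfolding push_def by (rule keys_frag_extend)
  also have "\<dots> \<subseteq> gens X U"
  proof (rule UN_least)
    fix e assume "e \<in> Poly_Mapping.keys c"
    then obtain S f x where "e = (S, f, x)" "finite S" "f \<in> FI_mor S T" "x \<in> X S"
      using assms(2) by (auto simp: gens_def)
    then show "Poly_Mapping.keys (case e of (S, f, x) \<Rightarrow> frag_of (S, compose S g f, x)) \<subseteq> gens X U"
      using FI_mor_compose[OF _ assms(1)] by (simp add: gens_def)
  qed
  finally show ?thesis .
qed

lemma push_push:
  assumes "Poly_Mapping.keys c \<subseteq> gens X S" "f \<in> FI_mor S T"
  shows "push g (push f c) = push (compose S g f) c"
  using assms(1)
proof (induction c rule: frag_induction)
  case (one e)
  then obtain R h x where e: "e = (R, h, x)" and h: "h \<in> FI_mor R S"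
    by (auto simp: gens_def)
  have "compose R g (compose R f h) = compose R (compose S g f) h"
    using h by (auto simp: compose_def FI_mor_def fun_eq_iff)
  then show ?case by (simp add: e push_frag_of)
qed (simp_all add: push_diff)

text \<open>A generator records its injection as an extensional function on the source, so composing
  with an inclusion of targets returns the same function.\<close>

lemma push_inclusion:
  assumes "Poly_Mapping.keys c \<subseteq> gens X T"
  shows "push (\<lambda>i\<in>T. i) c = c"
  using assms
proof (induction c rule: frag_induction)
  case (one e)
  then obtain S f x where e: "e = (S, f, x)" and f: "f \<in> FI_mor S T"
    by (auto simp: gens_def)
  have "compose S (\<lambda>i\<in>T. i) f = f"
    using f by (auto simp: compose_def FI_mor_def fun_eq_iff PiE_def extensional_def)
  then show ?case by (simp only: e push_frag_of)
qed (simp_all add: push_diff)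

lemma incl_free_FI:
  assumes "Poly_Mapping.keys c \<subseteq> gens X T"
  shows "incl (free_FI X) T U c = c"
  using push_inclusion[OF assms] by (simp add: incl_def free_FI_def)

lemma inclusion_diagram_free_FI: "inclusion_diagram (free_FI X)"
  unfolding inclusion_diagram_def
proof (intro conjI allI impI)
  show "comm_group (obj (free_FI X) S)" for S
    unfolding obj_free_FI by (rule abelian_free_Abelian_group)
  fix T S :: "nat set" assume TS: "T \<subseteq> S"
  show "incl (free_FI X) T S \<in> hom (obj (free_FI X) T) (obj (free_FI X) S)"
  proof (rule homI)
    fix x y assume x: "x \<in> carrier (obj (free_FI X) T)" and y: "y \<in> carrier (obj (free_FI X) T)"
    then have "Poly_Mapping.keys (x + y) \<subseteq> gens X T"
      using Poly_Mapping.keys_add[of x y] by (auto simp: obj_free_FI)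
    then show "incl (free_FI X) T S (x \<otimes>\<^bsub>obj (free_FI X) T\<^esub> y) =
        incl (free_FI X) T S x \<otimes>\<^bsub>obj (free_FI X) S\<^esub> incl (free_FI X) T S y"
      using x y by (simp add: obj_free_FI incl_free_FI)
  qed (use gens_mono[OF TS, of X] in \<open>auto simp: obj_free_FI incl_free_FI\<close>)
qed

lemma lower_free_FI:
  assumes T: "finite T"
  shows "lower (free_FI X) T =
    generate (free_Abelian_group (gens X T)) (\<Union>S\<in>{S. S \<subset> T}. {c. Poly_Mapping.keys c \<subseteq> gens X S})"
proof -
  have "incl (free_FI X) S T ` carrier (obj (free_FI X) S) = {c. Poly_Mapping.keys c \<subseteq> gens X S}" for S
    by (auto simp: obj_free_FI incl_free_FI image_iff)
  then show ?thesis
    unfolding lower_eq_generate[OF inclusion_diagram_free_FI T] by (simp add: obj_free_FI)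
qed

text \<open>Formal sums over a fixed proper subset are closed under negation, so an additive h maps
  the whole lower part into M as soon as it does so on each of these groups.\<close>

lemma lower_free_FI_least:
  assumes T: "finite T" and M: "diff_closed M"
    and h: "h 0 = 0" "\<And>c d. h (c + d) = h c + h d"
    and S: "\<And>S c. S \<subset> T \<Longrightarrow> Poly_Mapping.keys c \<subseteq> gens X S \<Longrightarrow> h c \<in> M"
    and c: "c \<in> lower (free_FI X) T"
  shows "h c \<in> M"
  using c unfolding lower_free_FI[OF T]
proof (induction c)
  case one
  then show ?case using h diff_closedD(1)[OF M] by simp
next
  case (incl c)
  then show ?case using S by blast
next
  case (inv c)
  then obtain R where R: "R \<subset> T" and cR: "Poly_Mapping.keys c \<subseteq> gens X R" by blast
  then have "inv\<^bsub>free_Abelian_group (gens X T)\<^esub> c = - c"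
    using gens_mono[of R T X] by (intro inv_free_Abelian_group) auto
  moreover have "h (- c) \<in> M"
    using R cR by (intro S[OF R]) simp
  ultimately show ?case by simp
next
  case (eng c d)
  then show ?case using h diff_closedD(4)[OF M] by simp
qed

lemma diff_closed_lower_free_FI:
  assumes T: "finite T"
  shows "diff_closed (lower (free_FI X) T)"
proof -
  have sg: "subgroup (lower (free_FI X) T) (free_Abelian_group (gens X T))"
    using lower_subgroup[OF inclusion_diagram_free_FI T] by (simp add: obj_free_FI)
  have "c - d \<in> lower (free_FI X) T" if "c \<in> lower (free_FI X) T" "d \<in> lower (free_FI X) T" for c d
  proof -
    have "Poly_Mapping.keys d \<subseteq> gens X T" using subgroup.mem_carrier[OF sg that(2)] by simp
    then have "- d \<in> lower (free_FI X) T" using subgroup.m_inv_closed[OF sg that(2)] by simp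
    then show ?thesis using subgroup.m_closed[OF sg that(1)] by fastforce
  qed
  then show ?thesis using subgroup.one_closed[OF sg] by (simp add: diff_closed_def)
qed

text \<open>A generator (S, f, x) lives over the image of f, a proper subset of T when f is not
  onto.\<close>

lemma in_lower_free_FI:
  assumes T: "finite T" and c: "Poly_Mapping.keys c \<subseteq> {(S, f, x) \<in> gens X T. f ` S \<noteq> T}"
  shows "c \<in> lower (free_FI X) T"
  using c
proof (induction c rule: frag_induction)
  case zero
  then show ?case using diff_closedD(1)[OF diff_closed_lower_free_FI[OF T]] .
next
  case (one e)
  obtain S f x where e: "e = (S, f, x)" by (cases e)
  have g: "finite S" "f \<in> FI_mor S T" "x \<in> X S" and ne: "f ` S \<noteq> T"
    using one by (simp_all add: e gens_def)
  have "f \<in> FI_mor S (f ` S)" using g(2) by (auto simp: FI_mor_def PiE_iff)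
  then have "Poly_Mapping.keys (frag_of e) \<subseteq> gens X (f ` S)"
    using g by (simp add: e gens_def)
  moreover have "f ` S \<subset> T" using g(2) ne by (auto simp: FI_mor_def)
  ultimately show ?case unfolding lower_free_FI[OF T] by (intro generate.incl) blast
next
  case (diff a b)
  then show ?case using diff_closedD(2)[OF diff_closed_lower_free_FI[OF T]] by blast
qed

section \<open>The augmentation from the free module on all elements\<close>

lemma free_Abelian_group_hom_eq:
  assumes G: "comm_group G" and h: "h \<in> hom (free_Abelian_group S) G" and k: "k \<in> hom (free_Abelian_group S) G"
    and eq: "\<And>e. e \<in> S \<Longrightarrow> h (frag_of e) = k (frag_of e)" and c: "Poly_Mapping.keys c \<subseteq> S"
  shows "h c = k c"
proof -
  interpret G: comm_group G by (rule G)
  interpret h: group_hom "free_Abelian_group S" G h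
    using h by (simp add: group_hom_def group_hom_axioms_def)
  interpret k: group_hom "free_Abelian_group S" G k
    using k by (simp add: group_hom_def group_hom_axioms_def)
  show ?thesis
    using c
  proof (induction c rule: free_Abelian_group_induct[consumes 1, case_names zero diff frag])
    case zero
    then show ?case using h.hom_one k.hom_one by simp
  next
    case (diff x y)
    let ?F = "free_Abelian_group S"
    have x: "x \<in> carrier ?F" and y: "y \<in> carrier ?F" using diff by simp_all
    have y': "inv\<^bsub>?F\<^esub> y \<in> carrier ?F" by (rule group.inv_closed[OF group_free_Abelian_group y])
    have "h (x \<otimes>\<^bsub>?F\<^esub> inv\<^bsub>?F\<^esub> y) = k (x \<otimes>\<^bsub>?F\<^esub> inv\<^bsub>?F\<^esub> y)"
      unfolding h.hom_mult[OF x y'] k.hom_mult[OF x y'] h.hom_inv[OF y] k.hom_inv[OF y]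
      by (simp only: diff)
    then show ?case using diff(2) by simp
  next
    case (frag e)
    then show ?case by (rule eq)
  qed
qed

text \<open>The product in \<open>augm\<close> runs over the support of its argument. Additivity
  needs one index set for c, d and c + d; the extra factors are zeroth powers.\<close>

lemma augm_eq_finprod:
  assumes V: "FI_module V" and T: "finite T" and c: "Poly_Mapping.keys c \<subseteq> gens (res_basis V 0) T"
    and E: "finite E" "Poly_Mapping.keys c \<subseteq> E" "E \<subseteq> gens (res_basis V 0) T"
  shows "augm V T c = finprod (obj V T)
       (\<lambda>(S, f, x). mor V S T f (elt x) [^]\<^bsub>obj V T\<^esub> Poly_Mapping.lookup c (S, f, x)) E"
proof -
  interpret G: comm_group "obj V T" by (rule FI_module_group(1)[OF V T])
  have "mor V S T f (elt x) \<in> carrier (obj V T)" if "(S, f, x) \<in> gens (res_basis V 0) T" for S f x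
    using that hom_in_carrier[OF FI_module_hom(1)[OF V _ T]] by (auto simp: gens_def)
  then show ?thesis
    unfolding augm_def
    by (intro G.finprod_mono_neutral_cong_left) (use E in \<open>auto simp: in_keys_iff subset_iff\<close>)
qed

lemma augm_hom:
  assumes V: "FI_module V" and T: "finite T"
  shows "augm V T \<in> hom (free_Abelian_group (gens (res_basis V 0) T)) (obj V T)"
proof (rule homI)
  let ?g = "gens (res_basis V 0) T"
  interpret G: comm_group "obj V T" by (rule FI_module_group(1)[OF V T])
  have cl: "mor V S T f (elt x) \<in> carrier (obj V T)" if "(S, f, x) \<in> ?g" for S f x
    using that hom_in_carrier[OF FI_module_hom(1)[OF V _ T]] by (auto simp: gens_def)
  show "augm V T c \<in> carrier (obj V T)" if "c \<in> carrier (free_Abelian_group ?g)" for c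
    unfolding augm_def using that cl by (intro G.finprod_closed) auto
  fix c d assume c: "c \<in> carrier (free_Abelian_group ?g)" and d: "d \<in> carrier (free_Abelian_group ?g)"
  let ?E = "Poly_Mapping.keys c \<union> Poly_Mapping.keys d"
  have E: "finite ?E" "?E \<subseteq> ?g" using c d by auto
  have cd: "Poly_Mapping.keys (c + d) \<subseteq> ?E" by (rule Poly_Mapping.keys_add)
  have "augm V T (c + d) = finprod (obj V T)
       (\<lambda>(S, f, x). mor V S T f (elt x) [^]\<^bsub>obj V T\<^esub> Poly_Mapping.lookup (c + d) (S, f, x)) ?E"
    using cd E by (intro augm_eq_finprod[OF V T]) auto
  also have "\<dots> = finprod (obj V T)
       (\<lambda>e. (case e of (S, f, x) \<Rightarrow> mor V S T f (elt x) [^]\<^bsub>obj V T\<^esub> Poly_Mapping.lookup c (S, f, x))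
         \<otimes>\<^bsub>obj V T\<^esub> (case e of (S, f, x) \<Rightarrow> mor V S T f (elt x) [^]\<^bsub>obj V T\<^esub> Poly_Mapping.lookup d (S, f, x))) ?E"
    using E cl by (intro G.finprod_cong') (auto simp: Poly_Mapping.lookup_add G.int_pow_mult subset_iff)
  also have "\<dots> = augm V T c \<otimes>\<^bsub>obj V T\<^esub> augm V T d"
  proof -
    let ?h = "\<lambda>c (S, f, x). mor V S T f (elt x) [^]\<^bsub>obj V T\<^esub> Poly_Mapping.lookup c (S, f, x)"
    have "augm V T c = finprod (obj V T) (?h c) ?E"
      using c E by (intro augm_eq_finprod[OF V T]) auto
    moreover have "augm V T d = finprod (obj V T) (?h d) ?E"
      using d E by (intro augm_eq_finprod[OF V T]) auto
    ultimately show ?thesis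
      using E cl by (subst G.finprod_multf) auto
  qed
  finally show "augm V T (c \<otimes>\<^bsub>free_Abelian_group ?g\<^esub> d) = augm V T c \<otimes>\<^bsub>obj V T\<^esub> augm V T d"
    by simp
qed

lemma augm_frag_of:
  assumes V: "FI_module V" and T: "finite T" and e: "(S, f, x) \<in> gens (res_basis V 0) T"
  shows "augm V T (frag_of (S, f, x)) = mor V S T f (elt x)"
proof -
  interpret G: comm_group "obj V T" by (rule FI_module_group(1)[OF V T])
  have "mor V S T f (elt x) \<in> carrier (obj V T)"
    using e hom_in_carrier[OF FI_module_hom(1)[OF V _ T]] by (auto simp: gens_def)
  then show ?thesis by (simp add: augm_def)
qed

lemma push_hom:
  assumes "g \<in> FI_mor T U"
  shows "push g \<in> hom (free_Abelian_group (gens X T)) (free_Abelian_group (gens X U))"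
  using keys_push[OF assms] by (intro homI) (auto simp: push_def frag_extend_add)

lemma augm_push:
  assumes V: "FI_module V" and T: "finite T" and U: "finite U" and g: "g \<in> FI_mor T U"
    and c: "Poly_Mapping.keys c \<subseteq> gens (res_basis V 0) T"
  shows "augm V U (push g c) = mor V T U g (augm V T c)"
proof -
  let ?X = "res_basis V 0"
  have "(augm V U \<circ> push g) c = (mor V T U g \<circ> augm V T) c"
  proof (rule free_Abelian_group_hom_eq[OF FI_module_group(1)[OF V U] _ _ _ c])
    show "augm V U \<circ> push g \<in> hom (free_Abelian_group (gens ?X T)) (obj V U)"
      by (rule Group.hom_compose[OF push_hom[OF g] augm_hom[OF V U]])
    show "mor V T U g \<circ> augm V T \<in> hom (free_Abelian_group (gens ?X T)) (obj V U)"
      by (rule Group.hom_compose[OF augm_hom[OF V T] FI_module_hom(1)[OF V T U g]])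
    fix e assume e: "e \<in> gens ?X T"
    obtain S f x where e_eq: "e = (S, f, x)" by (cases e)
    have S: "finite S" and f: "f \<in> FI_mor S T" and x: "x \<in> ?X S"
      using e by (simp_all add: e_eq gens_def)
    have x': "elt x \<in> carrier (obj V S)" using x by auto
    have "(S, compose S g f, x) \<in> gens ?X U"
      using S x FI_mor_compose[OF f g] by (simp add: gens_def)
    then show "(augm V U \<circ> push g) (frag_of e) = (mor V T U g \<circ> augm V T) (frag_of e)"
      using augm_frag_of[OF V T e[unfolded e_eq]] FI_module_compose[OF V S T U f g x']
      by (simp add: e_eq push_frag_of augm_frag_of[OF V U])
  qed
  then show ?thesis by simp
qed

section \<open>Syzygies and boundaries\<close>

declare res_basis.simps [simp del]

definition syzygies :: "'a fin_diagram \<Rightarrow> nat set \<Rightarrow> ('a cell gen \<Rightarrow>\<^sub>0 int) set" where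
  "syzygies V T = {c. Poly_Mapping.keys c \<subseteq> gens (res_basis V 0) T \<and> augm V T c = \<one>\<^bsub>obj V T\<^esub>}"

lemma diff_closed_syzygies:
  assumes V: "FI_module V" and T: "finite T"
  shows "diff_closed (syzygies V T)"
proof -
  let ?F = "free_Abelian_group (gens (res_basis V 0) T)"
  interpret h: group_hom ?F "obj V T" "augm V T"
    using augm_hom[OF V T] FI_module_group(2)[OF V T] by (simp add: group_hom_def group_hom_axioms_def)
  have eq: "syzygies V T = kernel ?F (obj V T) (augm V T)"
    by (auto simp: syzygies_def kernel_def)
  interpret K: subgroup "syzygies V T" ?F
    unfolding eq by (rule h.subgroup_kernel)
  have "c - d \<in> syzygies V T" if c: "c \<in> syzygies V T" and d: "d \<in> syzygies V T" for c d
  proof -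
    have "- d \<in> syzygies V T"
      using K.m_inv_closed[OF d] K.mem_carrier[OF d] by simp
    then show ?thesis using K.m_closed[OF c] by fastforce
  qed
  then show ?thesis using K.one_closed by (simp add: diff_closed_def)
qed

lemma push_syzygies:
  assumes V: "FI_module V" and T: "finite T" and U: "finite U" and g: "g \<in> FI_mor T U"
    and c: "c \<in> syzygies V T"
  shows "push g c \<in> syzygies V U"
  using c keys_push[OF g, of c "res_basis V 0"] augm_push[OF V T U g, of c]
    group_hom.hom_one[OF FI_module_hom(2)[OF V T U g]]
  by (simp add: syzygies_def)

lemma syzygies_mono:
  assumes V: "FI_module V" and U: "finite U" and TU: "T \<subseteq> U"
  shows "syzygies V T \<subseteq> syzygies V U"
proof
  fix c assume c: "c \<in> syzygies V T"
  then have "push (\<lambda>i\<in>T. i) c = c"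
    by (intro push_inclusion[where X = "res_basis V 0"]) (simp add: syzygies_def)
  then show "c \<in> syzygies V U"
    using push_syzygies[OF V finite_subset[OF TU U] U FI_mor_inclusion[OF TU] c] by simp
qed

lemma bd_frag_of: "bd (frag_of (S, f, x)) = push f (cell_bd x)"
  by (simp add: bd_def)

lemma bd_add: "bd (c + d) = bd c + bd d"
  by (simp add: bd_def frag_extend_add)

lemma bd_diff: "bd (c - d) = bd c - bd d"
  by (simp add: bd_def frag_extend_diff)

lemma bd_0 [simp]: "bd 0 = 0"
  by (simp add: bd_def)

lemma bd_syzygies:
  assumes V: "FI_module V" and T: "finite T" and c: "Poly_Mapping.keys c \<subseteq> gens (res_basis V 1) T"
  shows "bd c \<in> syzygies V T"
  using c
proof (induction c rule: frag_induction)
  case zero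
  then show ?case using diff_closedD(1)[OF diff_closed_syzygies[OF V T]] by simp
next
  case (one e)
  obtain S f x where e: "e = (S, f, x)" by (cases e)
  have S: "finite S" and f: "f \<in> FI_mor S T" and x: "x \<in> res_basis V 1 S"
    using one by (simp_all add: e gens_def)
  have "cell_bd x \<in> syzygies V S"
    using x by (auto simp: syzygies_def obj_free_FI res_basis.simps(2))
  then show ?case
    unfolding e bd_frag_of by (rule push_syzygies[OF V S T f])
next
  case (diff a b)
  then show ?case
    unfolding bd_diff by (rule diff_closedD(2)[OF diff_closed_syzygies[OF V T]])
qed

lemma bd_push:
  assumes c: "Poly_Mapping.keys c \<subseteq> gens (res_basis V 1) T"
  shows "bd (push g c) = push g (bd c)"
  using c
proof (induction c rule: frag_induction)
  case (one e)
  obtain S f x where e: "e = (S, f, x)" by (cases e)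
  have f: "f \<in> FI_mor S T" and x: "x \<in> res_basis V 1 S"
    using one by (simp_all add: e gens_def)
  have "Poly_Mapping.keys (cell_bd x) \<subseteq> gens (res_basis V 0) S"
    using x by (auto simp: obj_free_FI res_basis.simps(2))
  then show ?case
    unfolding e bd_frag_of push_frag_of by (rule push_push[OF _ f, symmetric])
qed (simp_all add: bd_diff push_diff)

lemma keys_bd:
  assumes c: "Poly_Mapping.keys c \<subseteq> gens (res_basis V (Suc n)) T"
  shows "Poly_Mapping.keys (bd c) \<subseteq> gens (res_basis V n) T"
  using c
proof (induction c rule: frag_induction)
  case (one e)
  obtain S f x where e: "e = (S, f, x)" by (cases e)
  have f: "f \<in> FI_mor S T" and x: "x \<in> res_basis V (Suc n) S"
    using one by (simp_all add: e gens_def)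
  have "Poly_Mapping.keys (cell_bd x) \<subseteq> gens (res_basis V n) S"
    using x by (auto simp: obj_free_FI res_basis.simps(2))
  then show ?case
    unfolding e bd_frag_of by (rule keys_push[OF f])
next
  case (diff a b)
  then show ?case
    using keys_diff[of "bd a" "bd b"] by (auto simp: bd_diff)
qed simp

lemma bd_bd:
  assumes c: "Poly_Mapping.keys c \<subseteq> gens (res_basis V 2) T"
  shows "bd (bd c) = 0"
  using c
proof (induction c rule: frag_induction)
  case (one e)
  obtain S f x where e: "e = (S, f, x)" by (cases e)
  have f: "f \<in> FI_mor S T" and x: "x \<in> res_basis V (Suc 1) S"
    using one by (simp_all add: e gens_def numeral_2_eq_2)
  obtain xs where x_eq: "x = Syz xs" and xs: "bd (comb xs) = 0"
    and k: "Poly_Mapping.keys (comb xs) \<subseteq> gens (res_basis V 1) S"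
    using x by (auto simp: obj_free_FI res_basis.simps(2))
  show ?case
    unfolding e bd_frag_of using bd_push[OF k] xs by (simp add: x_eq)
qed (simp_all add: bd_diff)

lemma comb_surj: "\<exists>xs. comb xs = c"
proof -
  obtain es where es: "set es = Poly_Mapping.keys c" "distinct es"
    using finite_distinct_list[of "Poly_Mapping.keys c"] by auto
  have "comb (map (\<lambda>e. (Poly_Mapping.lookup c e, e)) es) =
      (\<Sum>e\<leftarrow>es. frag_cmul (Poly_Mapping.lookup c e) (frag_of e))"
    by (simp add: comb_def comp_def)
  also have "\<dots> = frag_extend frag_of c"
    using es by (simp add: sum_list_distinct_conv_sum_set frag_extend_def)
  also have "\<dots> = c" by (rule frag_expansion[symmetric])
  finally show ?thesis by (rule exI)
qed

text \<open>The basis of P_1 has a cell for every listing of a syzygy, so a cell that lists c,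
  placed at T by the identity, has boundary c.\<close>

lemma syzygies_bd:
  assumes T: "finite T" and c: "c \<in> syzygies V T"
  obtains y where "Poly_Mapping.keys y \<subseteq> gens (res_basis V 1) T" "bd y = c"
proof -
  obtain xs where xs: "comb xs = c" using comb_surj by blast
  let ?y = "frag_of (T, \<lambda>i\<in>T. i, Syz xs)"
  have "Syz xs \<in> res_basis V 1 T"
    using c by (simp add: xs syzygies_def obj_free_FI res_basis.simps(2))
  then have "Poly_Mapping.keys ?y \<subseteq> gens (res_basis V 1) T"
    using T FI_mor_inclusion[of T T] by (simp add: gens_def)
  moreover have "bd ?y = c"
    unfolding bd_frag_of using push_inclusion[of c "res_basis V 0" T] c by (simp add: xs syzygies_def)
  ultimately show ?thesis by (rule that)
qed

lemma bd_lower: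
  fixes V :: "'a fin_diagram"
  assumes T: "finite T" and c: "c \<in> lower (res V (Suc n)) T"
  shows "bd c \<in> lower (res V n) T"
proof -
  let ?L = "lower (free_FI (res_basis V n)) T"
  have "bd c \<in> ?L"
  proof (rule lower_free_FI_least[OF T diff_closed_lower_free_FI[OF T], where h = bd])
    fix S and c :: "'a cell gen \<Rightarrow>\<^sub>0 int"
    assume S: "S \<subset> T" and c: "Poly_Mapping.keys c \<subseteq> gens (res_basis V (Suc n)) S"
    have "Poly_Mapping.keys (bd c) \<subseteq> gens (res_basis V n) S" by (rule keys_bd[OF c])
    then show "bd c \<in> ?L"
      unfolding lower_free_FI[OF T] using S by (intro generate.incl) blast
  qed (use c in \<open>simp_all add: bd_add res_def\<close>)
  then show ?thesis by (simp add: res_def)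
qed

text \<open>Exactness in the middle of the sequence of the \<open>H\<^sub>0(P\<^sub>n)\<close>, with cosets replaced by
  representatives.\<close>

lemma H1_zero_lift:
  assumes H: "is_zero (FI_H 1 V)" and T: "finite T"
    and y: "Poly_Mapping.keys y \<subseteq> gens (res_basis V 1) T" and bdy: "bd y \<in> lower (res V 0) T"
  obtains l z where "l \<in> lower (res V 1) T" "Poly_Mapping.keys z \<subseteq> gens (res_basis V 2) T"
    "y = l + bd z"
proof -
  define F where "F n = obj (res V n) T" for n
  define L where "L n = lower (res V n) T" for n
  have F: "F n = free_Abelian_group (gens (res_basis V n) T)" for n
    by (simp add: F_def res_def obj_free_FI)
  have diag: "inclusion_diagram (res V n)" for n
    unfolding res_def by (rule inclusion_diagram_free_FI)
  have sub: "subgroup (L n) (F n)" for n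
    unfolding L_def F_def by (rule lower_subgroup[OF diag T])
  have comm: "comm_group (F n)" for n
    unfolding F by (rule abelian_free_Abelian_group)
  have norm: "L n \<lhd> F n" for n
    using comm_group.subgroup_imp_normal[OF comm sub] .
  have dcL: "diff_closed (L n)" for n
    unfolding L_def res_def by (rule diff_closed_lower_free_FI[OF T])
  have bdL: "bd l \<in> L n" if "l \<in> L (Suc n)" for l n
    using bd_lower[OF T] that by (simp add: L_def)
  define \<psi> where "\<psi> n X = L n <#>\<^bsub>F n\<^esub> (bd ` X)" for n X
  define Q where "Q n = F n Mod L n" for n
  have Qcar: "carrier (Q n) = rcosets\<^bsub>F n\<^esub> L n" and Qone: "\<one>\<^bsub>Q n\<^esub> = L n"
    and Qmult: "X \<otimes>\<^bsub>Q n\<^esub> Y = X <#>\<^bsub>F n\<^esub> Y" for n X Y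
    by (simp_all add: Q_def FactGroup_def)
  define Ker where "Ker = kernel (Q 1) (Q 0) (\<psi> 0)"
  define Im where "Im = \<psi> 1 ` carrier (Q 2)"
  have "obj (FI_H 1 V) T = (Q 1)\<lparr>carrier := Ker\<rparr> Mod Im"
    by (simp add: FI_H_def homology_at_def quotient_module_def submodule_def FI_H0_def FI_H0_map_def[abs_def]
        res_diff_def Ker_def Im_def \<psi>_def[abs_def] Q_def F_def L_def numeral_2_eq_2)
  moreover have "carrier (obj (FI_H 1 V) T) = {\<one>\<^bsub>obj (FI_H 1 V) T\<^esub>}"
    using H T unfolding is_zero_def by blast
  ultimately have triv: "rcosets\<^bsub>(Q 1)\<lparr>carrier := Ker\<rparr>\<^esub> Im = {Im}"
    by (simp add: FactGroup_def)
  have \<psi>L: "\<psi> n X = L n" if ne: "X \<noteq> {}" and bdX: "bd ` X \<subseteq> L n" for n X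
  proof -
    obtain x where x: "x \<in> X" using ne by blast
    have "l \<in> L n <#>\<^bsub>F n\<^esub> (bd ` X)" if l: "l \<in> L n" for l
    proof -
      have "l - bd x \<in> L n" using diff_closedD(2)[OF dcL l] x bdX by blast
      then have "(l - bd x) \<otimes>\<^bsub>F n\<^esub> bd x \<in> L n <#>\<^bsub>F n\<^esub> (bd ` X)"
        using x by (intro in_set_multI) auto
      then show ?thesis by (simp add: F)
    qed
    moreover have "l + m \<in> L n" if "l \<in> L n" "m \<in> bd ` X" for l m
      using that bdX diff_closedD(4)[OF dcL] by blast
    ultimately show ?thesis
      unfolding \<psi>_def by (auto simp: F elim!: in_set_multE)
  qed
  define X where "X = L 1 #>\<^bsub>F 1\<^esub> y"
  have yX: "y \<in> X"
    unfolding X_def using y by (intro group.rcos_self[OF _ _ sub]) (simp_all add: F)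
  have XQ: "X \<in> carrier (Q 1)"
    unfolding X_def Qcar using y by (auto simp: RCOSETS_def F)
  have "bd ` X \<subseteq> L 0"
  proof
    fix m assume "m \<in> bd ` X"
    then obtain l where l: "l \<in> L (Suc 0)" and m: "m = bd (l + y)"
      by (auto simp: X_def r_coset_def F)
    show "m \<in> L 0"
      unfolding m bd_add using bdL[OF l] bdy by (intro diff_closedD(4)[OF dcL]) (simp_all add: L_def)
  qed
  then have "\<psi> 0 X = L 0" using yX by (intro \<psi>L) auto
  then have X: "X \<in> Ker"
    using XQ by (simp add: Ker_def kernel_def Qone)
  have "Im #>\<^bsub>(Q 1)\<lparr>carrier := Ker\<rparr>\<^esub> X \<in> rcosets\<^bsub>(Q 1)\<lparr>carrier := Ker\<rparr>\<^esub> Im"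
    using X by (auto simp: RCOSETS_def)
  then have coset: "Im #>\<^bsub>(Q 1)\<lparr>carrier := Ker\<rparr>\<^esub> X = Im"
    using triv by simp
  \<comment> \<open>Triviality of the homology says that the coset of X modulo \<open>Im\<close> is
    \<open>Im\<close>. Since \<open>Im\<close> contains the identity \<open>L 1\<close>, this coset
    contains X, and so X lies in \<open>Im\<close>.\<close>
  have "L 1 \<in> Im"
  proof -
    have "L 2 \<in> carrier (Q 2)"
      unfolding Qcar using subgroup.subgroup_in_rcosets[OF sub] comm_group.axioms(2)[OF comm] by blast
    moreover have "\<psi> 1 (L 2) = L 1"
      using bdL[of _ 1] diff_closedD(1)[OF dcL, of 2] by (intro \<psi>L) (auto simp: numeral_2_eq_2)
    ultimately show ?thesis unfolding Im_def by (metis imageI)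
  qed
  then have "L 1 \<otimes>\<^bsub>Q 1\<^esub> X \<in> Im"
    using coset by (auto simp: r_coset_def)
  moreover have "L 1 \<otimes>\<^bsub>Q 1\<^esub> X = X"
    unfolding Qmult using XQ by (intro normal.rcosets_mult_eq[OF norm]) (simp add: Qcar)
  ultimately have "X \<in> Im" by simp
  then obtain Y where Y: "Y \<in> rcosets\<^bsub>F 2\<^esub> L 2" and XY: "X = L 1 <#>\<^bsub>F 1\<^esub> (bd ` Y)"
    by (auto simp: Im_def \<psi>_def Qcar)
  have Yc: "Y \<subseteq> carrier (F 2)"
    using Y subgroup.rcosets_carrier[OF sub comm_group.axioms(2)[OF comm]] by blast
  obtain l z where l: "l \<in> L 1" and z: "z \<in> Y" and y_eq: "y = l + bd z"
    using yX unfolding XY by (auto simp: F elim!: in_set_multE)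
  have "z \<in> carrier (F 2)" using z Yc by blast
  then have "Poly_Mapping.keys z \<subseteq> gens (res_basis V 2) T" by (simp add: F)
  then show ?thesis
    by (rule that[OF l[unfolded L_def] _ y_eq])
qed

text \<open>Write c = bd y. As c is in the lower part of P_0, the class of y in H_0(P_1) is a cycle,
  so y = l + bd z with l in the lower part of P_1. Then c = bd l, and the summands of l come from
  proper subsets, where their boundaries are again syzygies.\<close>

lemma syzygies_pure:
  fixes V :: "'a fin_diagram"
  assumes V: "FI_module V" and H: "is_zero (FI_H 1 V)" and T: "finite T"
    and c: "c \<in> syzygies V T" and ne: "\<forall>(S, f, x)\<in>Poly_Mapping.keys c. f ` S \<noteq> T"
  shows "c \<in> family_sum T (\<lambda>i. syzygies V (T - {i}))"
proof -
  obtain y where y: "Poly_Mapping.keys y \<subseteq> gens (res_basis V 1) T" and bdy: "bd y = c"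
    by (rule syzygies_bd[OF T c])
  have "c \<in> lower (res V 0) T"
    unfolding res_def using c ne by (intro in_lower_free_FI[OF T]) (auto simp: syzygies_def)
  then obtain l z where l: "l \<in> lower (res V 1) T"
    and z: "Poly_Mapping.keys z \<subseteq> gens (res_basis V 2) T" and yl: "y = l + bd z"
    using H1_zero_lift[OF H T y] bdy by auto
  have dc: "diff_closed (syzygies V (T - {i}))" for i
    using T by (intro diff_closed_syzygies[OF V]) simp
  have "bd l \<in> family_sum T (\<lambda>i. syzygies V (T - {i}))"
  proof (rule lower_free_FI_least[OF T diff_closed_family_sum, where h = bd])
    fix S and d :: "'a cell gen \<Rightarrow>\<^sub>0 int"
    assume S: "S \<subset> T" and d: "Poly_Mapping.keys d \<subseteq> gens (res_basis V 1) S"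
    obtain i where i: "i \<in> T" "i \<notin> S" using S by blast
    have "bd d \<in> syzygies V S"
      using S T d by (intro bd_syzygies[OF V]) (auto intro: finite_subset)
    also have "\<dots> \<subseteq> syzygies V (T - {i})"
      using S i T by (intro syzygies_mono[OF V]) auto
    finally show "bd d \<in> family_sum T (\<lambda>i. syzygies V (T - {i}))"
      by (rule family_sum_upper[OF T dc i(1)])
  qed (use l dc in \<open>simp_all add: bd_add res_def\<close>)
  moreover have "bd l = c"
    using bdy bd_bd[OF z] by (simp add: yl bd_add)
  ultimately show ?thesis by simp
qed

subsection \<open>Vanishing of \<open>H\<^sub>1\<close> implies torsion-free derivatives\<close>

text \<open>The inclusion of \<open>P\<^sub>0\<close> at \<open>R\<close> into \<open>P\<^sub>0\<close> at \<open>T\<close> is the identity on formal sums, so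
  that the sum of the images for \<open>R = T - {i}\<close>, \<open>i \<in> J\<close>, is free on these generators.\<close>

definition avoiding :: "'a fin_diagram \<Rightarrow> nat set \<Rightarrow> nat set \<Rightarrow> 'a cell gen set" where
  "avoiding V J T = {(S, f, x) \<in> gens (res_basis V 0) T. \<not> J \<subseteq> f ` S}"

lemma augm_group_hom:
  assumes V: "FI_module V" and T: "finite T"
  shows "group_hom (free_Abelian_group (gens (res_basis V 0) T)) (obj V T) (augm V T)"
  using augm_hom[OF V T] FI_module_group(2)[OF V T] by (simp add: group_hom_def group_hom_axioms_def)

lemma augm_diff:
  assumes V: "FI_module V" and T: "finite T"
    and c: "Poly_Mapping.keys c \<subseteq> gens (res_basis V 0) T"
    and d: "Poly_Mapping.keys d \<subseteq> gens (res_basis V 0) T"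
  shows "augm V T (c - d) = augm V T c \<otimes>\<^bsub>obj V T\<^esub> inv\<^bsub>obj V T\<^esub> augm V T d"
proof -
  let ?F = "free_Abelian_group (gens (res_basis V 0) T)"
  interpret h: group_hom ?F "obj V T" "augm V T" by (rule augm_group_hom[OF V T])
  have c': "c \<in> carrier ?F" and d': "d \<in> carrier ?F" using c d by simp_all
  have "augm V T (c \<otimes>\<^bsub>?F\<^esub> inv\<^bsub>?F\<^esub> d) = augm V T c \<otimes>\<^bsub>obj V T\<^esub> inv\<^bsub>obj V T\<^esub> augm V T d"
    by (simp only: h.hom_mult[OF c' h.G.inv_closed[OF d']] h.hom_inv[OF d'])
  then show ?thesis using d by simp
qed

lemma augm_incl:
  assumes V: "FI_module V" and U: "finite U" and TU: "T \<subseteq> U"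
    and c: "Poly_Mapping.keys c \<subseteq> gens (res_basis V 0) T"
  shows "augm V U c = incl V T U (augm V T c)"
  using augm_push[OF V finite_subset[OF TU U] U FI_mor_inclusion[OF TU] c] push_inclusion[OF c]
  by (simp only: incl_def)

lemma augm_avoiding:
  assumes V: "FI_module V" and T: "finite T"
    and c: "Poly_Mapping.keys c \<subseteq> avoiding V J T"
  shows "augm V T c \<in> lower_along V J T"
proof -
  interpret h: group_hom "free_Abelian_group (gens (res_basis V 0) T)" "obj V T" "augm V T"
    by (rule augm_group_hom[OF V T])
  note sg = lower_along_subgroup[OF V T, of J]
  have sub: "avoiding V J T \<subseteq> gens (res_basis V 0) T"
    by (auto simp: avoiding_def)
  show ?thesis
    using c
  proof (induction c rule: free_Abelian_group_induct[consumes 1, case_names zero diff frag])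
    case zero
    then show ?case using h.hom_one subgroup.one_closed[OF sg] by simp
  next
    case (diff c d)
    then show ?case
      using augm_diff[OF V T order_trans[OF diff(1) sub] order_trans[OF diff(2) sub]]
        subgroup.m_closed[OF sg] subgroup.m_inv_closed[OF sg] by simp
  next
    case (frag e)
    obtain S f x where e: "e = (S, f, x)" by (cases e)
    have g: "(S, f, x) \<in> gens (res_basis V 0) T" and J: "\<not> J \<subseteq> f ` S"
      using frag by (simp_all add: e avoiding_def)
    have S: "finite S" "f \<in> FI_mor S T" and x: "elt x \<in> carrier (obj V S)"
      using g by (auto simp: gens_def res_basis.simps(1))
    obtain i where "i \<in> J" "i \<notin> f ` S" using J by blast
    then show ?case
      unfolding e augm_frag_of[OF V T g] by (rule mor_in_lower_along[OF V S(1) T S(2) _ _ x])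
  qed
qed

lemma augm_surj:
  assumes V: "FI_module V" and T: "finite T" and v: "v \<in> carrier (obj V T)"
  obtains c where "Poly_Mapping.keys c \<subseteq> gens (res_basis V 0) T" "augm V T c = v"
proof -
  have g: "(T, \<lambda>i\<in>T. i, Elt v) \<in> gens (res_basis V 0) T"
    using T v FI_mor_inclusion[of T T] by (auto simp: gens_def res_basis.simps(1))
  have "augm V T (frag_of (T, \<lambda>i\<in>T. i, Elt v)) = v"
    unfolding augm_frag_of[OF V T g] using incl_refl[OF V T v] by (simp only: incl_def cell.sel)
  then show ?thesis using g by (intro that[of "frag_of (T, \<lambda>i\<in>T. i, Elt v)"]) simp_all
qed

text \<open>The augmentation is onto at each T - {i}, and generators over T - {i} with i in J do not
  cover J; so sums of generators that avoid J reach every generator of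
  \<open>lower_along V J T\<close>.\<close>

lemma lower_along_augm:
  assumes V: "FI_module V" and T: "finite T" and v: "v \<in> lower_along V J T" and J: "J \<subseteq> T"
  obtains c where "Poly_Mapping.keys c \<subseteq> avoiding V J T" "augm V T c = v"
proof -
  let ?F = "free_Abelian_group (gens (res_basis V 0) T)" and ?F' = "free_Abelian_group (avoiding V J T)"
  interpret h: group_hom ?F "obj V T" "augm V T" by (rule augm_group_hom[OF V T])
  have sub: "avoiding V J T \<subseteq> gens (res_basis V 0) T"
    by (auto simp: avoiding_def)
  have "augm V T \<in> hom ?F' (obj V T)"
  proof (rule homI)
    show "augm V T c \<in> carrier (obj V T)" if "c \<in> carrier ?F'" for c
      using that sub by (intro h.hom_closed) auto
    show "augm V T (c \<otimes>\<^bsub>?F'\<^esub> d) = augm V T c \<otimes>\<^bsub>obj V T\<^esub> augm V T d"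
      if "c \<in> carrier ?F'" "d \<in> carrier ?F'" for c d
    proof -
      have "c \<in> carrier ?F" "d \<in> carrier ?F" using that sub by auto
      then show ?thesis using h.hom_mult by fastforce
    qed
  qed
  then have "group_hom ?F' (obj V T) (augm V T)"
    by (simp add: group_hom_def group_hom_axioms_def)
  then have sg: "subgroup (augm V T ` carrier ?F') (obj V T)"
    by (rule group_hom.img_is_subgroup)
  have "lower_along V J T \<subseteq> augm V T ` carrier ?F'"
  proof (rule lower_along_least[OF V T sg])
    fix i x assume i: "i \<in> J" and x: "x \<in> carrier (obj V (T - {i}))"
    obtain c where c: "Poly_Mapping.keys c \<subseteq> gens (res_basis V 0) (T - {i})"
      and cx: "augm V (T - {i}) c = x"
      using T by (auto intro: augm_surj[OF V _ x])
    have "gens (res_basis V 0) (T - {i}) \<subseteq> avoiding V J T"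
    proof
      fix e assume "e \<in> gens (res_basis V 0) (T - {i})"
      moreover obtain S f x where "e = (S, f, x)" by (cases e)
      ultimately show "e \<in> avoiding V J T"
        using i FI_mor_mono[of f S "T - {i}" T] by (auto simp: avoiding_def gens_def FI_mor_def PiE_iff)
    qed
    then have "c \<in> carrier ?F'" using c by auto
    moreover have "incl V (T - {i}) T x = augm V T c"
      using augm_incl[OF V T Diff_subset c] cx by simp
    ultimately show "incl V (T - {i}) T x \<in> augm V T ` carrier ?F'" by simp
  qed
  then obtain c where "c \<in> carrier ?F'" "v = augm V T c" using v by blast
  then show ?thesis by (intro that[of c]) simp_all
qed

text \<open>Lift v to p over T, and its image over U = insert s T to a sum q avoiding J. No support
  in the syzygy p - q contains insert s J: those of p miss s, those of q do not contain J. Purity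
  splits p - q into syzygies over U - {i} for i in insert s J. The one for i = s lives over T, and
  subtracting it from p gives a lift of v that avoids J.\<close>

theorem H1_zero_imp_derivatives_torsion_free:
  fixes V :: "'a fin_diagram"
  assumes V: "FI_module V" and H: "is_zero (FI_H 1 V)"
  shows "derivatives_torsion_free V"
  unfolding derivatives_torsion_free_def
proof (intro allI impI)
  fix T J :: "nat set" and s v
  assume T: "finite T" and s: "s \<notin> T" and J: "J \<subseteq> T" and v: "v \<in> carrier (obj V T)"
    and low: "incl V T (insert s T) v \<in> lower_along V J (insert s T)"
  define U where "U = insert s T"
  define \<sigma> :: "'a cell gen \<Rightarrow> nat set" where "\<sigma> = (\<lambda>(S, f, x). f ` S)"
  have U: "finite U" and TU: "T \<subseteq> U" and Us: "U - {s} = T" using T s by (auto simp: U_def)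
  have dc: "diff_closed (syzygies V R)" if "R \<subseteq> U" for R
    by (rule diff_closed_syzygies[OF V finite_subset[OF that U]])
  have supp: "\<sigma> e \<subseteq> R" if "e \<in> Poly_Mapping.keys c" "Poly_Mapping.keys c \<subseteq> gens (res_basis V 0) R"
    for c :: "'a cell gen \<Rightarrow>\<^sub>0 int" and e R
    using that by (force simp: \<sigma>_def gens_def FI_mor_def)
  obtain p where p: "Poly_Mapping.keys p \<subseteq> gens (res_basis V 0) T" and pv: "augm V T p = v"
    by (rule augm_surj[OF V T v])
  obtain q where q: "Poly_Mapping.keys q \<subseteq> avoiding V J U" and qv: "augm V U q = incl V T U v"
    using lower_along_augm[OF V U low[folded U_def]] J TU by blast
  have qg: "Poly_Mapping.keys q \<subseteq> gens (res_basis V 0) U"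
    using q by (auto simp: avoiding_def)
  have pU: "Poly_Mapping.keys p \<subseteq> gens (res_basis V 0) U"
    using p gens_mono[OF TU] by blast
  have qJ: "\<not> J \<subseteq> \<sigma> e" if "e \<in> Poly_Mapping.keys q" for e
    using q that by (auto simp: avoiding_def \<sigma>_def)
  interpret GU: comm_group "obj V U" by (rule FI_module_group(1)[OF V U])
  have "augm V U (p - q) = \<one>\<^bsub>obj V U\<^esub>"
    using augm_diff[OF V U pU qg] augm_incl[OF V U TU p] qv incl_closed[OF V U TU v] by (simp add: pv)
  then have pq: "p - q \<in> syzygies V U"
    using keys_diff[of p q] pU qg by (auto simp: syzygies_def)
  have "p - q \<in> family_sum (insert s J) (\<lambda>i. syzygies V (U - {i}))"
  proof (rule purity_along[where K = "syzygies V" and \<sigma> = \<sigma>, OF U dc])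
    show "syzygies V R \<subseteq> syzygies V R'" if "R \<subseteq> R'" "R' \<subseteq> U" for R R'
      by (rule syzygies_mono[OF V finite_subset[OF that(2) U] that(1)])
    show "\<sigma> e \<subseteq> R" if "R \<subseteq> U" "x \<in> syzygies V R" "e \<in> Poly_Mapping.keys x" for R x e
      using supp[OF that(3)] that(2) by (simp add: syzygies_def)
    show "x \<in> family_sum R (\<lambda>i. syzygies V (R - {i}))"
      if "R \<subseteq> U" "x \<in> syzygies V R" "\<forall>e\<in>Poly_Mapping.keys x. \<sigma> e \<noteq> R" for R x
      using that(3) by (intro syzygies_pure[OF V H finite_subset[OF that(1) U] that(2)]) (auto simp: \<sigma>_def)
    show "insert s J \<subseteq> U" using J by (auto simp: U_def)
    show "p - q \<in> syzygies V U" by (rule pq)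
    show "\<forall>e\<in>Poly_Mapping.keys (p - q). \<not> insert s J \<subseteq> \<sigma> e"
    proof
      fix e assume "e \<in> Poly_Mapping.keys (p - q)"
      then consider "e \<in> Poly_Mapping.keys p" | "e \<in> Poly_Mapping.keys q"
        using keys_diff[of p q] by blast
      then show "\<not> insert s J \<subseteq> \<sigma> e"
        by cases (use supp[OF _ p] s qJ in blast)+
    qed
  qed
  then obtain \<kappa> where pq_eq: "p - q = sum \<kappa> (insert s J)"
    and \<kappa>: "\<And>i. i \<in> insert s J \<Longrightarrow> \<kappa> i \<in> syzygies V (U - {i})"
    unfolding family_sum_def by auto
  have \<kappa>s: "\<kappa> s \<in> syzygies V T" using \<kappa>[of s] Us by simp
  have fJ: "finite J" "s \<notin> J" using J T s finite_subset by auto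
  \<comment> \<open>The left side is a formal sum over T. On the right, the supports in q do not
    contain J and those in \<open>\<kappa> i\<close> miss i, so no support contains J.\<close>
  have eq: "p - \<kappa> s = q + sum \<kappa> J"
    using pq_eq fJ by (simp add: algebra_simps)
  have keysT: "Poly_Mapping.keys (p - \<kappa> s) \<subseteq> gens (res_basis V 0) T"
    using keys_diff[of p "\<kappa> s"] p \<kappa>s by (auto simp: syzygies_def)
  have "\<not> J \<subseteq> \<sigma> e" if e: "e \<in> Poly_Mapping.keys (p - \<kappa> s)" for e
  proof
    assume Je: "J \<subseteq> \<sigma> e"
    have "Poly_Mapping.lookup (\<kappa> i) e = 0" if i: "i \<in> J" for i
    proof (rule ccontr)
      assume "Poly_Mapping.lookup (\<kappa> i) e \<noteq> 0"
      then have "\<sigma> e \<subseteq> U - {i}"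
        using supp[of e "\<kappa> i"] \<kappa>[of i] i by (simp add: syzygies_def in_keys_iff)
      then show False using Je i by blast
    qed
    moreover have "Poly_Mapping.lookup q e = 0"
      using qJ[of e] Je by (metis in_keys_iff)
    ultimately have "Poly_Mapping.lookup (p - \<kappa> s) e = 0"
      unfolding eq lookup_add lookup_sum by simp
    then show False using e by (simp add: in_keys_iff)
  qed
  then have "Poly_Mapping.keys (p - \<kappa> s) \<subseteq> avoiding V J T"
    using keysT by (auto simp: avoiding_def \<sigma>_def)
  then have "augm V T (p - \<kappa> s) \<in> lower_along V J T"
    by (rule augm_avoiding[OF V T])
  moreover have "augm V T (p - \<kappa> s) = v"
  proof -
    interpret GT: comm_group "obj V T" by (rule FI_module_group(1)[OF V T])
    show ?thesis
      using augm_diff[OF V T p, of "\<kappa> s"] \<kappa>s v by (simp add: syzygies_def pv)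
  qed
  ultimately show "v \<in> lower_along V J T" by simp
qed

subsection \<open>Subquotients\<close>

text \<open>The lower part of a subquotient depends on inclusions, which is why K and N are required
  to be stable under these.\<close>

locale FI_subquotient =
  fixes V :: "'a fin_diagram" and K N :: "nat set \<Rightarrow> 'a set"
  assumes V: "FI_module V"
    and K: "\<And>S. finite S \<Longrightarrow> subgroup (K S) (obj V S)"
    and N: "\<And>S. finite S \<Longrightarrow> subgroup (N S) (obj V S)"
    and NK: "\<And>S. finite S \<Longrightarrow> N S \<subseteq> K S"
    and inclK: "\<And>S T x. finite S \<Longrightarrow> T \<subseteq> S \<Longrightarrow> x \<in> K T \<Longrightarrow> incl V T S x \<in> K S"
    and inclN: "\<And>S T x. finite S \<Longrightarrow> T \<subseteq> S \<Longrightarrow> x \<in> N T \<Longrightarrow> incl V T S x \<in> N S"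
begin

abbreviation W :: "'a set fin_diagram" where
  "W \<equiv> quotient_module (submodule V K) N"

abbreviation sub :: "nat set \<Rightarrow> 'a monoid" where
  "sub S \<equiv> (obj V S)\<lparr>carrier := K S\<rparr>"

lemma obj_W: "obj W S = sub S Mod N S"
  by (simp add: quotient_module_def submodule_def)

lemma incl_W: "incl W T S X = N S <#>\<^bsub>sub S\<^esub> (incl V T S ` X)"
  by (simp add: incl_def quotient_module_def submodule_def)

lemma sub_comm_group:
  assumes "finite S"
  shows "comm_group (sub S)"
proof -
  interpret G: comm_group "obj V S" by (rule FI_module_group(1)[OF V assms])
  show ?thesis
  proof (rule group.group_comm_groupI)
    show "group (sub S)" by (rule G.subgroup_imp_group[OF K[OF assms]])
    show "x \<otimes>\<^bsub>sub S\<^esub> y = y \<otimes>\<^bsub>sub S\<^esub> x" if "x \<in> carrier (sub S)" "y \<in> carrier (sub S)" for x y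
      using that subgroup.mem_carrier[OF K[OF assms]] G.m_comm by simp
  qed
qed

lemma N_normal:
  assumes "finite S"
  shows "N S \<lhd> sub S"
proof -
  have "subgroup (N S) (sub S)"
    by (rule group.subgroup_incl[OF FI_module_group(2)[OF V assms] N[OF assms] K[OF assms] NK[OF assms]])
  then show ?thesis by (rule comm_group.subgroup_imp_normal[OF sub_comm_group[OF assms]])
qed

lemma incl_hom_sub:
  assumes "finite S" "T \<subseteq> S"
  shows "group_hom (sub T) (sub S) (incl V T S)"
proof -
  have T: "finite T" using assms finite_subset by blast
  have "incl V T S \<in> hom (sub T) (sub S)"
  proof (rule homI)
    show "incl V T S x \<in> carrier (sub S)" if "x \<in> carrier (sub T)" for x
      using that inclK[OF assms] by simp
    show "incl V T S (x \<otimes>\<^bsub>sub T\<^esub> y) = incl V T S x \<otimes>\<^bsub>sub S\<^esub> incl V T S y"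
      if "x \<in> carrier (sub T)" "y \<in> carrier (sub T)" for x y
      using that hom_mult[OF incl_hom(1)[OF V assms]] subgroup.mem_carrier[OF K[OF T]] by simp
  qed
  then show ?thesis
    using comm_group.axioms(2)[OF sub_comm_group[OF T]] comm_group.axioms(2)[OF sub_comm_group[OF assms(1)]]
    by (simp add: group_hom_def group_hom_axioms_def)
qed

text \<open>The inclusion carries N T into N S, so the factor N S in the maps of a quotient module
  absorbs the image of N T.\<close>

lemma incl_W_coset:
  assumes S: "finite S" and TS: "T \<subseteq> S" and x: "x \<in> K T"
  shows "incl W T S (N T #>\<^bsub>sub T\<^esub> x) = N S #>\<^bsub>sub S\<^esub> incl V T S x"
proof -
  have T: "finite T" using S TS finite_subset by blast
  interpret h: group_hom "sub T" "sub S" "incl V T S" by (rule incl_hom_sub[OF S TS])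
  interpret NT: normal "N T" "sub T" by (rule N_normal[OF T])
  interpret NS: normal "N S" "sub S" by (rule N_normal[OF S])
  have xT: "x \<in> carrier (sub T)" using x by simp
  have \<iota>: "incl V T S (n \<otimes>\<^bsub>sub T\<^esub> x) = incl V T S n \<otimes>\<^bsub>sub S\<^esub> incl V T S x" if "n \<in> N T" for n
    by (rule h.hom_mult[OF NT.mem_carrier[OF that] xT])
  have \<iota>x: "incl V T S x \<in> carrier (sub S)" by (rule h.hom_closed[OF xT])
  show ?thesis
  proof
    show "incl W T S (N T #>\<^bsub>sub T\<^esub> x) \<subseteq> N S #>\<^bsub>sub S\<^esub> incl V T S x"
    proof
      fix z assume "z \<in> incl W T S (N T #>\<^bsub>sub T\<^esub> x)"
      then obtain m y where m: "m \<in> N S" and y: "y \<in> N T #>\<^bsub>sub T\<^esub> x"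
        and z: "z = m \<otimes>\<^bsub>sub S\<^esub> incl V T S y"
        unfolding incl_W by (auto elim!: in_set_multE)
      obtain n where n: "n \<in> N T" and y_eq: "y = n \<otimes>\<^bsub>sub T\<^esub> x"
        using y unfolding r_coset_def by blast
      have n': "incl V T S n \<in> N S" by (rule inclN[OF S TS n])
      have "z = (m \<otimes>\<^bsub>sub S\<^esub> incl V T S n) \<otimes>\<^bsub>sub S\<^esub> incl V T S x"
        unfolding z y_eq \<iota>[OF n]
        by (rule h.H.m_assoc[OF NS.mem_carrier[OF m] NS.mem_carrier[OF n'] \<iota>x, symmetric])
      moreover have "m \<otimes>\<^bsub>sub S\<^esub> incl V T S n \<in> N S" by (rule NS.m_closed[OF m n'])
      ultimately show "z \<in> N S #>\<^bsub>sub S\<^esub> incl V T S x"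
        unfolding r_coset_def by blast
    qed
    show "N S #>\<^bsub>sub S\<^esub> incl V T S x \<subseteq> incl W T S (N T #>\<^bsub>sub T\<^esub> x)"
    proof
      fix z assume "z \<in> N S #>\<^bsub>sub S\<^esub> incl V T S x"
      then obtain m where m: "m \<in> N S" and z: "z = m \<otimes>\<^bsub>sub S\<^esub> incl V T S x"
        unfolding r_coset_def by blast
      have "x \<in> N T #>\<^bsub>sub T\<^esub> x"
        by (rule h.G.rcos_self[OF xT NT.subgroup_axioms])
      then show "z \<in> incl W T S (N T #>\<^bsub>sub T\<^esub> x)"
        unfolding z incl_W by (intro in_set_multI[OF m] imageI)
    qed
  qed
qed

lemma carrier_W: "carrier (obj W S) = (\<lambda>x. N S #>\<^bsub>sub S\<^esub> x) ` K S"
  by (auto simp: obj_W FactGroup_def RCOSETS_def)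

lemma W_comm_group:
  assumes S: "finite S"
  shows "comm_group (obj W S)"
proof -
  interpret G: comm_group "sub S" by (rule sub_comm_group[OF S])
  interpret normal "N S" "sub S" by (rule N_normal[OF S])
  show ?thesis
  proof (rule group.group_comm_groupI)
    show "group (obj W S)" unfolding obj_W by (rule factorgroup_is_group)
    fix X Y assume "X \<in> carrier (obj W S)" "Y \<in> carrier (obj W S)"
    then obtain x y where x: "x \<in> carrier (sub S)" "X = N S #>\<^bsub>sub S\<^esub> x"
      and y: "y \<in> carrier (sub S)" "Y = N S #>\<^bsub>sub S\<^esub> y"
      unfolding carrier_W by auto
    show "X \<otimes>\<^bsub>obj W S\<^esub> Y = Y \<otimes>\<^bsub>obj W S\<^esub> X"
      unfolding obj_W mult_FactGroup x(2) y(2) rcos_sum[OF x(1) y(1)] rcos_sum[OF y(1) x(1)]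
        G.m_comm[OF x(1) y(1)] ..
  qed
qed

lemma coset_group_hom:
  assumes S: "finite S"
  shows "group_hom (sub S) (obj W S) (\<lambda>x. N S #>\<^bsub>sub S\<^esub> x)"
  using normal.r_coset_hom_Mod[OF N_normal[OF S]] comm_group.axioms(2)[OF sub_comm_group[OF S]]
    comm_group.axioms(2)[OF W_comm_group[OF S]]
  by (simp add: group_hom_def group_hom_axioms_def obj_W)

lemma W_inclusion_diagram: "inclusion_diagram W"
  unfolding inclusion_diagram_def
proof (intro conjI allI impI)
  show "comm_group (obj W S)" if "finite S" for S by (rule W_comm_group[OF that])
  fix T S :: "nat set" assume S: "finite S" and TS: "T \<subseteq> S"
  have T: "finite T" using S TS finite_subset by blast
  interpret h: group_hom "sub T" "sub S" "incl V T S" by (rule incl_hom_sub[OF S TS])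
  interpret qT: group_hom "sub T" "obj W T" "\<lambda>x. N T #>\<^bsub>sub T\<^esub> x" by (rule coset_group_hom[OF T])
  interpret qS: group_hom "sub S" "obj W S" "\<lambda>x. N S #>\<^bsub>sub S\<^esub> x" by (rule coset_group_hom[OF S])
  show "incl W T S \<in> hom (obj W T) (obj W S)"
  proof (rule homI)
    fix X assume "X \<in> carrier (obj W T)"
    then show "incl W T S X \<in> carrier (obj W S)"
      unfolding carrier_W using incl_W_coset[OF S TS] inclK[OF S TS] by auto
    fix Y assume Y: "Y \<in> carrier (obj W T)"
    obtain x where x: "x \<in> K T" "X = N T #>\<^bsub>sub T\<^esub> x"
      using \<open>X \<in> carrier (obj W T)\<close> unfolding carrier_W by blast
    obtain y where y: "y \<in> K T" "Y = N T #>\<^bsub>sub T\<^esub> y"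
      using Y unfolding carrier_W by blast
    have xy: "x \<in> carrier (sub T)" "y \<in> carrier (sub T)" using x y by simp_all
    have xyK: "x \<otimes>\<^bsub>sub T\<^esub> y \<in> K T" using h.G.m_closed[OF xy] by simp
    have "incl W T S (X \<otimes>\<^bsub>obj W T\<^esub> Y) = incl W T S (N T #>\<^bsub>sub T\<^esub> (x \<otimes>\<^bsub>sub T\<^esub> y))"
      unfolding x(2) y(2) qT.hom_mult[OF xy] ..
    also have "\<dots> = N S #>\<^bsub>sub S\<^esub> (incl V T S x \<otimes>\<^bsub>sub S\<^esub> incl V T S y)"
      unfolding incl_W_coset[OF S TS xyK] h.hom_mult[OF xy] ..
    also have "\<dots> = incl W T S X \<otimes>\<^bsub>obj W S\<^esub> incl W T S Y"
      unfolding x(2) y(2) incl_W_coset[OF S TS x(1)] incl_W_coset[OF S TS y(1)]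
      by (rule qS.hom_mult[OF h.hom_closed[OF xy(1)] h.hom_closed[OF xy(2)]])
    finally show "incl W T S (X \<otimes>\<^bsub>obj W T\<^esub> Y) = incl W T S X \<otimes>\<^bsub>obj W S\<^esub> incl W T S Y" .
  qed
qed

text \<open>The coset of an element coming from K (S - {i}) is the image of a coset over S - {i}, so
  generation of K from proper subsets passes to the quotient.\<close>

lemma lower_W_eq_carrier:
  assumes S: "finite S"
    and gen: "K S \<subseteq> generate (obj V S) (\<Union>i\<in>S. incl V (S - {i}) S ` K (S - {i}))" (is "_ \<subseteq> generate _ ?X")
  shows "lower W S = carrier (obj W S)"
proof
  note D = W_inclusion_diagram
  show "lower W S \<subseteq> carrier (obj W S)"
    by (rule subgroup.subset[OF lower_subgroup[OF D S]])
  have XK: "?X \<subseteq> K S" using inclK[OF S Diff_subset] by blast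
  have "N S #>\<^bsub>sub S\<^esub> x \<in> lower W S" if x: "x \<in> K S" for x
  proof (rule hom_image_generate[OF coset_group_hom[OF S] _ lower_subgroup[OF D S]])
    show "?X \<subseteq> carrier (sub S)" using XK by simp
    show "x \<in> generate (sub S) ?X"
      using gen x group.generate_consistent[OF FI_module_group(2)[OF V S] XK K[OF S]] by blast
    fix y assume "y \<in> ?X"
    then obtain i z where i: "i \<in> S" and z: "z \<in> K (S - {i})" and y: "y = incl V (S - {i}) S z"
      by blast
    have "N S #>\<^bsub>sub S\<^esub> y = incl W (S - {i}) S (N (S - {i}) #>\<^bsub>sub (S - {i})\<^esub> z)"
      unfolding y by (rule incl_W_coset[OF S Diff_subset z, symmetric])
    moreover have "N (S - {i}) #>\<^bsub>sub (S - {i})\<^esub> z \<in> carrier (obj W (S - {i}))"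
      unfolding carrier_W using z by blast
    moreover have "S - {i} \<subset> S" using i by blast
    ultimately show "N S #>\<^bsub>sub S\<^esub> y \<in> lower W S"
      unfolding lower_eq_generate[OF D S] by (intro generate.incl) blast
  qed
  then show "carrier (obj W S) \<subseteq> lower W S"
    unfolding carrier_W by blast
qed

end

section \<open>From the kernel to the homology of the complex\<close>

lemma generated_below_iff:
  assumes V: "FI_module V" and n: "-1 \<le> n"
  shows "generated_below V n \<longleftrightarrow> generated_in_degrees_le V n"
  unfolding generated_in_degrees_le_iff[OF FI_module_inclusion_diagram[OF V] n] generated_below_def
  using lower_eq_lower_along[OF V] lower_along_subset[OF V] by (metis subset_antisym order_refl)

text \<open>For J = {} the part along J is trivial, so \<open>Z J\<close> is the kernel itself and
  the generators of \<open>G J\<close> are exactly its elements over the sets S - {i}.\<close>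

lemma (in FI_map_into_torsion_free) kernel_generated:
  assumes S: "finite S" and c: "min (2 * a) (a + b) < card S"
  shows "kernel (obj A S) (obj B S) (\<phi> S) \<subseteq> generate (obj A S)
    (\<Union>i\<in>S. incl A (S - {i}) S ` kernel (obj A (S - {i})) (obj B (S - {i})) (\<phi> (S - {i})))"
proof -
  have Z: "Z {} T = kernel (obj A T) (obj B T) (\<phi> T)" if "finite T" for T
    using group.generate_empty[OF FI_module_group(2)[OF B that]]
    by (auto simp: Z_def kernel_def lower_along_def)
  have "Z {} S \<subseteq> G {} S"
    using c by (intro Z_subset_G[OF S]) auto
  then show ?thesis
    using S by (simp add: G_def G_gens_def Z)
qed

theorem corollaryB:
  fixes C :: "int \<Rightarrow> 'a fin_diagram"
    and d :: "int \<Rightarrow> nat set \<Rightarrow> 'a \<Rightarrow> 'a"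
    and g :: "int \<Rightarrow> int"
    and k :: int
  assumes "FI_chain_complex C d"
    and "\<And>j. H0_acyclic (C j)"
    and "\<And>j. g j \<ge> - 1"
    and "\<And>j. generated_in_degrees_le (C j) (g j)"
    and "g k \<ge> 0"
  shows "generated_in_degrees_le (complex_homology C d k)
           (if g k > g (k - 1) then g (k - 1) + g k + 1 else 2 * g k)"
proof -
  have C: "FI_module (C j)" and d: "FI_module_map (C j) (C (j - 1)) (d j)"
    and dd: "finite S \<Longrightarrow> x \<in> carrier (obj (C j) S) \<Longrightarrow> d (j - 1) S (d j S x) = \<one>\<^bsub>obj (C (j - 2)) S\<^esub>"
    for j S x
    using assms(1) by (simp_all add: FI_chain_complex_def)
  have d': "FI_module_map (C (k + 1)) (C k) (d (k + 1))"
    using d[of "k + 1"] by simp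
  \<comment> \<open>The shift by one makes b a faithful natural number also when g (k - 1) = -1, the
    case of a zero module.\<close>
  define a b where "a = nat (g k)" and "b = nat (g (k - 1) + 1)"
  have ab: "int a = g k" "int b = g (k - 1) + 1"
    using assms(3)[of "k - 1"] assms(5) by (simp_all add: a_def b_def)
  let ?n = "if g k > g (k - 1) then g (k - 1) + g k + 1 else 2 * g k"
  \<comment> \<open>The case distinction is this minimum: a + b = g (k - 1) + g k + 1 is at most 2 *
    a exactly when g k > g (k - 1).\<close>
  have n: "int (min (2 * a) (a + b)) \<le> ?n" "-1 \<le> ?n"
    using ab by auto
  interpret FI_map_into_torsion_free "C k" "C (k - 1)" "d k" a b
  proof
    show "generated_below (C k) (int a)"
      unfolding ab generated_below_iff[OF C assms(3)] by (rule assms(4))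
    have "generated_below (C (k - 1)) (g (k - 1))"
      unfolding generated_below_iff[OF C assms(3)] by (rule assms(4))
    then show "generated_below (C (k - 1)) (int b - 1)"
      by (simp add: ab)
    show "derivatives_torsion_free (C (k - 1))"
      using assms(2)[of "k - 1"] C
      by (intro H1_zero_imp_derivatives_torsion_free) (auto simp: H0_acyclic_def)
  qed (rule C C d)+
  define K where "K = (\<lambda>S. kernel (obj (C k) S) (obj (C (k - 1)) S) (d k S))"
  define N where "N = (\<lambda>S. d (k + 1) S ` carrier (obj (C (k + 1)) S))"
  have hK: "group_hom (obj (C k) S) (obj (C (k - 1)) S) (d k S)" if "finite S" for S
    by (rule FI_module_map_hom[OF C C d that])
  have hN: "group_hom (obj (C (k + 1)) S) (obj (C k) S) (d (k + 1) S)" if "finite S" for S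
    by (rule FI_module_map_hom[OF C C d' that])
  interpret H: FI_subquotient "C k" K N
  proof (rule FI_subquotient.intro)
    show "FI_module (C k)" by (rule C)
    fix S :: "nat set" assume S: "finite S"
    show "subgroup (K S) (obj (C k) S)"
      unfolding K_def by (rule group_hom.subgroup_kernel[OF hK[OF S]])
    show "subgroup (N S) (obj (C k) S)"
      unfolding N_def by (rule group_hom.img_is_subgroup[OF hN[OF S]])
    show "N S \<subseteq> K S"
      using dd[OF S, of _ "k + 1"] group_hom.hom_closed[OF hN[OF S]] by (auto simp: N_def K_def kernel_def)
    fix T x assume T: "T \<subseteq> S"
    have fT: "finite T" by (rule finite_subset[OF T S])
    show "incl (C k) T S x \<in> K S" if "x \<in> K T"
      using that FI_module_map_incl[OF d S T] incl_closed[OF C S T]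
        group_hom.hom_one[OF incl_hom(2)[OF C S T]]
      by (simp add: K_def kernel_def)
    show "incl (C k) T S x \<in> N S" if "x \<in> N T"
    proof -
      obtain y where y: "y \<in> carrier (obj (C (k + 1)) T)" "x = d (k + 1) T y"
        using \<open>x \<in> N T\<close> by (auto simp: N_def)
      then have "incl (C k) T S x = d (k + 1) S (incl (C (k + 1)) T S y)"
        using FI_module_map_incl[OF d' S T] by simp
      then show ?thesis
        using incl_closed[OF C S T y(1)] by (simp add: N_def)
    qed
  qed
  have homology: "complex_homology C d k = quotient_module (submodule (C k) K) N"
    by (simp add: complex_homology_def homology_at_def K_def N_def)
  show ?thesis
    unfolding homology generated_in_degrees_le_iff[OF H.W_inclusion_diagram n(2)]
  proof (intro allI impI)
    fix S :: "nat set" assume S: "finite S" and "?n < int (card S)"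
    then have "min (2 * a) (a + b) < card S" using n(1) by linarith
    then show "lower (quotient_module (submodule (C k) K) N) S =
        carrier (obj (quotient_module (submodule (C k) K) N) S)"
      using kernel_generated[OF S] by (intro H.lower_W_eq_carrier[OF S]) (simp add: K_def)
  qed
qed

end
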